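(* Let $T=[x_0,\dots,x_n]\subset\mathbb R^n$ be an $n$-simplex, $f\in\Delta(T)$, $r\ge1$, $0\le k\le n$, let $E=E^{k,r}_{f,T}:\mathcal P_r\Lambda^k(f)\to\mathcal P_r\Lambda^k(T)$ be the extension operator defined in the context, and let $$\mathcal P_r\Lambda^k(T,f)=\{\omega\in\mathcal P_r\Lambda^k(T)\mid\omega\text{ vanishes to order }r^+\text{ on }f^*\}.$$ Then $\mathcal P_r\Lambda^k(T,f)=E[\mathcal P_r\Lambda^k(f)]$, and for each $\mu\in\mathcal P_r\Lambda^k(f)$, $E\mu$ is the unique extension of $\mu$ to $\mathcal P_r\Lambda^k(T,f)$, i.e. the unique $\omega\in\mathcal P_r\Lambda^k(T,f)$ with $\operatorname{tr}_{T,f}\omega=\mu$.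
   Context: $\Delta(T)$ is the set of all nonempty faces of $T$ of all dimensions (including $T$). $\mathcal I(f)\subseteq\{0,\dots,n\}$ is the set of indices of the vertices of $f$, and $f^*$ is the face of $T$ opposite $f$, with index set $\mathcal I(f^* )=\{0,\dots,n\}\setminus\mathcal I(f)$ (empty if $f=T$). For $i\in\mathcal I(f)$, $\lambda_i^f$ is the affine function on $f$ with $\lambda_i^f(x_j)=\delta_{ij}$, $j\in\mathcal I(f)$. $\operatorname{tr}_{T,f}$ is the pullback of differential forms under the inclusion $f\hookrightarrow T$. $\mathcal P_r\Lambda^k(f)$ is the space of differential $k$-forms on $f$ with coefficients polynomials of degree at most $r$. For a multi-index $\alpha=(\alpha_i)_{i\in\mathcal I(f)}$ of nonnegative integers with $|\alpha|=r$ and an increasing map $\sigma:\{1,\dots,k\}\to\mathcal I(f)$, put $d\lambda^f_\sigma=d\lambda^f_{\sigma(1)}\wedge\cdots\wedge d\lambda^f_{\sigma(k)}$, $$\psi_i^{\alpha,f,T}=d\lambda_i^T-\frac{\alpha_i}{|\alpha|}\sum_{j\in\mathcal I(f)}d\lambda_j^T\quad(i\in\mathcal I(f)),\qquad \psi_\sigma^{\alpha,f,T}=\psi^{\alpha,f,T}_{\sigma(1)}\wedge\cdots\wedge\psi^{\alpha,f,T}_{\sigma(k)}.$$ $E^{k,r}_{f,T}$ is the unique (well-defined) linear map with $E^{k,r}_{f,T}[(\lambda^f)^\alpha d\lambda^f_\sigma]=(\lambda^T)^\alpha\psi^{\alpha,f,T}_\sigma$ for all such $\alpha,\sigma$. (For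 $k=0$, $\sigma$ is the empty map and $d\lambda^f_\sigma=1=\psi^{\alpha,f,T}_\sigma$.) A smooth function $u$ on $T$ vanishes to order $r$ at $x$ if all its partial derivatives of order at most $r-1$ vanish at $x$. A smooth $k$-form $\omega$ on $T$ vanishes to order $r$ on a set if for all $v_1,\dots,v_k\in\mathbb R^n$ the function $y\mapsto\omega_y(v_1,\dots,v_k)$ vanishes to order $r$ at each point of the set. A form $\omega\in\mathcal P_r\Lambda^k(T)$ vanishes to order $r^+$ on $f^*$ if it vanishes to order $r$ on $f^*$ and $$(\partial^\alpha_{t_l}\omega)\,\lrcorner\,t_{\alpha l}=0\quad\text{for all }l\in\mathcal I(f^* )\text{ and all }\alpha=(\alpha_i)_{i\in\mathcal I(f)}\text{ with }|\alpha|=r,$$ where $t_{jl}=x_j-x_l$, $\partial_{t_{jl}}=t_{jl}\cdot\nabla$ is the directional derivative (acting on the coefficients of $\omega$), $\partial^\alpha_{t_l}=\prod_{j\in\mathcal I(f)}\partial_{t_{jl}}^{\alpha_j}$, $t_{\alpha l}=\frac1{|\alpha|}\sum_{m\in\mathcal I(f)}\alpha_m(x_m-x_l)$, and $(a\lrcorner v)(v_1,\dots,v_{k-1})=a(v,v_1,\dots,v_{k-1})$ is contraction (which is $0$ for $k=0$). *)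

theory Defs
  imports "HOL-Analysis.Analysis"
begin

text \<open>
  The simplex \<open>T = [x\<^sub>0, \<dots>, x\<^sub>n]\<close> in \<open>\<real>\<^sup>n\<close>, \<open>n = CARD('n)\<close>, is given by its family of vertices
  \<open>x :: nat \<Rightarrow> real ^ 'n\<close>, of which only the values at \<open>0, \<dots>, n\<close> matter.  Faces are sets of points.
\<close>

definition is_simplex :: "(nat \<Rightarrow> real ^ 'n) \<Rightarrow> bool" where
  "is_simplex x \<longleftrightarrow> inj_on x {..CARD('n)} \<and> \<not> affine_dependent (x ` {..CARD('n)})"

definition simplex_of :: "(nat \<Rightarrow> real ^ 'n) \<Rightarrow> (real ^ 'n) set" where
  "simplex_of x = convex hull (x ` {..CARD('n)})"

definition faces :: "(nat \<Rightarrow> real ^ 'n) \<Rightarrow> (real ^ 'n) set set" where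
  "faces x = {f. f face_of simplex_of x \<and> f \<noteq> {}}"

definition indices :: "(nat \<Rightarrow> real ^ 'n) \<Rightarrow> (real ^ 'n) set \<Rightarrow> nat set" where
  "indices x f = {i. i \<le> CARD('n) \<and> x i extreme_point_of f}"

definition opp_indices :: "(nat \<Rightarrow> real ^ 'n) \<Rightarrow> (real ^ 'n) set \<Rightarrow> nat set" where
  "opp_indices x f = {..CARD('n)} - indices x f"

definition opp_face :: "(nat \<Rightarrow> real ^ 'n) \<Rightarrow> (real ^ 'n) set \<Rightarrow> (real ^ 'n) set" where
  "opp_face x f = convex hull (x ` opp_indices x f)"


text \<open>
  A differential \<open>k\<close>-form on a convex set \<open>S\<close> is a function of a point of \<open>S\<close> and a list of \<open>k\<close>
  tangent vectors.  Forms are normalised to be \<open>0\<close> on all other arguments, so that equality of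
  forms is equality of functions.
\<close>

type_synonym 'n form = "real ^ 'n \<Rightarrow> (real ^ 'n) list \<Rightarrow> real"

definition tangent :: "(real ^ 'n) set \<Rightarrow> (real ^ 'n) set" where
  "tangent S = span {a - b |a b. a \<in> S \<and> b \<in> S}"

definition form_args :: "nat \<Rightarrow> (real ^ 'n) set \<Rightarrow> (real ^ 'n) list set" where
  "form_args k S = {vs. length vs = k \<and> set vs \<subseteq> tangent S}"

definition multilinear_alternating ::
    "nat \<Rightarrow> (real ^ 'n) set \<Rightarrow> ((real ^ 'n) list \<Rightarrow> real) \<Rightarrow> bool" where
  "multilinear_alternating k S a \<longleftrightarrow>
     (\<forall>vs \<in> form_args k S. \<forall>i<k. \<forall>u \<in> tangent S. \<forall>w \<in> tangent S. \<forall>c d.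
        a (vs[i := c *\<^sub>R u + d *\<^sub>R w]) = c * a (vs[i := u]) + d * a (vs[i := w])) \<and>
     (\<forall>vs \<in> form_args k S. \<forall>i<k. \<forall>j<k. i \<noteq> j \<and> vs ! i = vs ! j \<longrightarrow> a vs = 0)"

definition is_form :: "nat \<Rightarrow> (real ^ 'n) set \<Rightarrow> 'n form \<Rightarrow> bool" where
  "is_form k S \<omega> \<longleftrightarrow>
     (\<forall>y \<in> S. multilinear_alternating k S (\<omega> y)) \<and>
     (\<forall>y vs. \<not> (y \<in> S \<and> vs \<in> form_args k S) \<longrightarrow> \<omega> y vs = 0)"

definition poly_fun :: "nat \<Rightarrow> (real ^ 'n \<Rightarrow> real) \<Rightarrow> bool" where
  "poly_fun r p \<longleftrightarrow>
     (\<exists>c. \<forall>y. p y = (\<Sum>m \<in> {m :: 'n \<Rightarrow> nat. sum m UNIV \<le> r}. c m * (\<Prod>i\<in>UNIV. (y $ i) ^ m i)))"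

definition poly_forms :: "nat \<Rightarrow> nat \<Rightarrow> (real ^ 'n) set \<Rightarrow> 'n form set" where
  "poly_forms r k S =
     {\<omega>. is_form k S \<omega> \<and>
         (\<forall>vs \<in> form_args k S. \<exists>p. poly_fun r p \<and> (\<forall>y\<in>S. \<omega> y vs = p y))}"

text \<open>Pullback under the inclusion of \<open>f\<close>.\<close>

definition trace_form :: "(real ^ 'n) set \<Rightarrow> 'n form \<Rightarrow> 'n form" where
  "trace_form f \<omega> = (\<lambda>y vs. if y \<in> f \<and> set vs \<subseteq> tangent f then \<omega> y vs else 0)"

text \<open>
  Directional derivative of a function on \<open>S\<close>, taken within \<open>S\<close>.  If \<open>u\<close> is differentiable
  within a convex set \<open>S\<close>, its value at a point of \<open>S\<close>, boundary points included, is uniquely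
  determined for every \<open>v \<in> tangent S\<close>.
\<close>

definition dir_deriv ::
    "(real ^ 'n) set \<Rightarrow> real ^ 'n \<Rightarrow> (real ^ 'n \<Rightarrow> real) \<Rightarrow> real ^ 'n \<Rightarrow> real" where
  "dir_deriv S v u = (\<lambda>y. frechet_derivative u (at y within S) v)"


text \<open>Barycentric coordinates \<open>\<lambda>\<^sub>i\<^sup>f\<close>, normalised to be \<open>0\<close> off \<open>f\<close>; only used for \<open>i \<in> indices x f\<close>.\<close>

definition affine_fun_on :: "(real ^ 'n) set \<Rightarrow> (real ^ 'n \<Rightarrow> real) \<Rightarrow> bool" where
  "affine_fun_on S u \<longleftrightarrow>
     (\<forall>a\<in>S. \<forall>b\<in>S. \<forall>t\<in>{0..1}. u ((1 - t) *\<^sub>R a + t *\<^sub>R b) = (1 - t) * u a + t * u b)"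

definition bary ::
    "(nat \<Rightarrow> real ^ 'n) \<Rightarrow> (real ^ 'n) set \<Rightarrow> nat \<Rightarrow> real ^ 'n \<Rightarrow> real" where
  "bary x f i = (THE u. affine_fun_on f u \<and>
                        (\<forall>j \<in> indices x f. u (x j) = (if i = j then 1 else 0)) \<and>
                        (\<forall>y. y \<notin> f \<longrightarrow> u y = 0))"

definition d_bary ::
    "(nat \<Rightarrow> real ^ 'n) \<Rightarrow> (real ^ 'n) set \<Rightarrow> nat \<Rightarrow> real ^ 'n \<Rightarrow> real ^ 'n \<Rightarrow> real" where
  "d_bary x f i = (\<lambda>y v. dir_deriv f v (bary x f i) y)"

definition bary_monomial ::
    "(nat \<Rightarrow> real ^ 'n) \<Rightarrow> (real ^ 'n) set \<Rightarrow> (real ^ 'n) set \<Rightarrow> (nat \<Rightarrow> nat) \<Rightarrow> real ^ 'n \<Rightarrow> real" where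
  "bary_monomial x f S \<alpha> = (\<lambda>y. \<Prod>i\<in>indices x f. bary x S i y ^ \<alpha> i)"

text \<open>
  \<open>\<theta>\<^sub>1 \<and> \<dots> \<and> \<theta>\<^sub>k\<close> for a list of \<open>1\<close>-forms \<open>\<theta>\<^sub>i\<close> on \<open>S\<close>: its value at \<open>(v\<^sub>1, \<dots>, v\<^sub>k)\<close> is the
  determinant of \<open>(\<theta>\<^sub>i(v\<^sub>j))\<close>.
\<close>

definition wedge :: "(real ^ 'n) set \<Rightarrow> (real ^ 'n \<Rightarrow> real ^ 'n \<Rightarrow> real) list \<Rightarrow> 'n form" where
  "wedge S \<theta>s = (\<lambda>y vs.
     if y \<in> S \<and> vs \<in> form_args (length \<theta>s) S
     then \<Sum>p | p permutes {..<length \<theta>s}.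
            of_int (sign p) * (\<Prod>i<length \<theta>s. (\<theta>s ! i) y (vs ! p i))
     else 0)"

text \<open>Multi-indices over \<open>I\<close>, and increasing maps \<open>{1, \<dots>, k} \<rightarrow> I\<close> as strictly increasing lists.\<close>

definition multi_indices :: "nat set \<Rightarrow> nat \<Rightarrow> (nat \<Rightarrow> nat) set" where
  "multi_indices I r = {\<alpha>. (\<forall>i. i \<notin> I \<longrightarrow> \<alpha> i = 0) \<and> sum \<alpha> I = r}"

definition increasing_lists :: "nat set \<Rightarrow> nat \<Rightarrow> nat list set" where
  "increasing_lists I k = {\<sigma>. length \<sigma> = k \<and> sorted_wrt (<) \<sigma> \<and> set \<sigma> \<subseteq> I}"

definition psi ::
    "(nat \<Rightarrow> real ^ 'n) \<Rightarrow> (real ^ 'n) set \<Rightarrow> (nat \<Rightarrow> nat) \<Rightarrow> nat \<Rightarrow> real ^ 'n \<Rightarrow> real ^ 'n \<Rightarrow> real" where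
  "psi x f \<alpha> i = (\<lambda>y v.
     d_bary x (simplex_of x) i y v
     - (of_nat (\<alpha> i) / of_nat (sum \<alpha> (indices x f)))
       * (\<Sum>j\<in>indices x f. d_bary x (simplex_of x) j y v))"

definition is_extension_operator ::
    "(nat \<Rightarrow> real ^ 'n) \<Rightarrow> (real ^ 'n) set \<Rightarrow> nat \<Rightarrow> nat \<Rightarrow> ('n form \<Rightarrow> 'n form) \<Rightarrow> bool" where
  "is_extension_operator x f k r E \<longleftrightarrow>
     (\<forall>\<mu> \<in> poly_forms r k f. E \<mu> \<in> poly_forms r k (simplex_of x)) \<and>
     (\<forall>\<mu> \<in> poly_forms r k f. \<forall>\<nu> \<in> poly_forms r k f. \<forall>c d.
        E (\<lambda>y vs. c * \<mu> y vs + d * \<nu> y vs) = (\<lambda>y vs. c * E \<mu> y vs + d * E \<nu> y vs)) \<and>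
     (\<forall>\<alpha> \<in> multi_indices (indices x f) r. \<forall>\<sigma> \<in> increasing_lists (indices x f) k.
        E (\<lambda>y vs. bary_monomial x f f \<alpha> y * wedge f (map (d_bary x f) \<sigma>) y vs)
        = (\<lambda>y vs. bary_monomial x f (simplex_of x) \<alpha> y
                   * wedge (simplex_of x) (map (psi x f \<alpha>) \<sigma>) y vs))"

text \<open>The last conjunct fixes the values outside the domain \<open>poly_forms r k f\<close> of the operator.\<close>

definition extension_operator ::
    "(nat \<Rightarrow> real ^ 'n) \<Rightarrow> (real ^ 'n) set \<Rightarrow> nat \<Rightarrow> nat \<Rightarrow> 'n form \<Rightarrow> 'n form" where
  "extension_operator x f k r =
     (THE E. is_extension_operator x f k r E \<and>
             (\<forall>\<mu>. \<mu> \<notin> poly_forms r k f \<longrightarrow> E \<mu> = (\<lambda>y vs. 0)))"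


text \<open>
  The iterated partial derivatives of order at most \<open>r - 1\<close> are indexed by the lists of fewer
  than \<open>r\<close> coordinate directions.
\<close>

definition vanishes_to_order_at ::
    "(real ^ 'n) set \<Rightarrow> nat \<Rightarrow> (real ^ 'n \<Rightarrow> real) \<Rightarrow> real ^ 'n \<Rightarrow> bool" where
  "vanishes_to_order_at S r u y \<longleftrightarrow>
     (\<forall>is :: 'n list. length is < r \<longrightarrow> foldr (\<lambda>i. dir_deriv S (axis i 1)) is u y = 0)"

definition form_vanishes_to_order ::
    "(nat \<Rightarrow> real ^ 'n) \<Rightarrow> nat \<Rightarrow> nat \<Rightarrow> 'n form \<Rightarrow> (real ^ 'n) set \<Rightarrow> bool" where
  "form_vanishes_to_order x k r \<omega> A \<longleftrightarrow>
     (\<forall>vs. length vs = k \<longrightarrow>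
        (\<forall>y\<in>A. vanishes_to_order_at (simplex_of x) r (\<lambda>z. \<omega> z vs) y))"

text \<open>The factors of \<open>\<partial>\<^sup>\<alpha>\<close> commute on smooth functions; here they are composed in increasing order.\<close>

definition multi_deriv ::
    "(nat \<Rightarrow> real ^ 'n) \<Rightarrow> (real ^ 'n) set \<Rightarrow> nat \<Rightarrow> (nat \<Rightarrow> nat) \<Rightarrow> (real ^ 'n \<Rightarrow> real) \<Rightarrow> real ^ 'n \<Rightarrow> real" where
  "multi_deriv x f l \<alpha> u =
     foldr (\<lambda>j. dir_deriv (simplex_of x) (x j - x l) ^^ \<alpha> j) (sorted_list_of_set (indices x f)) u"

definition t_vec ::
    "(nat \<Rightarrow> real ^ 'n) \<Rightarrow> (real ^ 'n) set \<Rightarrow> nat \<Rightarrow> (nat \<Rightarrow> nat) \<Rightarrow> real ^ 'n" where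
  "t_vec x f l \<alpha> =
     (1 / of_nat (sum \<alpha> (indices x f))) *\<^sub>R (\<Sum>m\<in>indices x f. of_nat (\<alpha> m) *\<^sub>R (x m - x l))"

definition contract ::
    "nat \<Rightarrow> ((real ^ 'n) list \<Rightarrow> real) \<Rightarrow> real ^ 'n \<Rightarrow> (real ^ 'n) list \<Rightarrow> real" where
  "contract k a v = (\<lambda>vs. if k = 0 then 0 else a (v # vs))"

definition vanishes_to_order_plus ::
    "(nat \<Rightarrow> real ^ 'n) \<Rightarrow> (real ^ 'n) set \<Rightarrow> nat \<Rightarrow> nat \<Rightarrow> 'n form \<Rightarrow> bool" where
  "vanishes_to_order_plus x f k r \<omega> \<longleftrightarrow>
     form_vanishes_to_order x k r \<omega> (opp_face x f) \<and>
     (\<forall>l \<in> opp_indices x f. \<forall>\<alpha> \<in> multi_indices (indices x f) r.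
        \<forall>y \<in> simplex_of x. \<forall>vs. length vs = k - 1 \<longrightarrow>
          contract k (\<lambda>ws. multi_deriv x f l \<alpha> (\<lambda>z. \<omega> z ws) y) (t_vec x f l \<alpha>) vs = 0)"

definition poly_forms_vanishing ::
    "(nat \<Rightarrow> real ^ 'n) \<Rightarrow> (real ^ 'n) set \<Rightarrow> nat \<Rightarrow> nat \<Rightarrow> 'n form set" where
  "poly_forms_vanishing x f r k =
     {\<omega> \<in> poly_forms r k (simplex_of x). vanishes_to_order_plus x f k r \<omega>}"

end

theory Submission
  imports Defs
begin

text \<open>
  Write a form on a face as \<open>\<Sum>\<^sub>\<beta> \<lambda>\<^sup>\<beta> a\<^sub>\<beta>\<close> with \<open>|\<beta>| = r\<close> and alternating coefficients \<open>a\<^sub>\<beta>\<close> on its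
  tangent space; these coefficients are unique.  The extension operator pulls \<open>a\<^sub>\<alpha>\<close> back along a linear projection
  \<open>\<pi>\<^sub>\<alpha>\<close> of \<open>\<real>\<^sup>n\<close> onto the tangent space of \<open>f\<close> whose kernel is spanned by the vectors \<open>t\<^bsub>\<alpha>l\<^esub>\<close> with
  \<open>l\<close> outside \<open>\<I>(f)\<close>; in particular it is well defined.  On \<open>T\<close>, vanishing to order \<open>r\<close> on \<open>f\<^sup>*\<close> means that
  only multi-indices supported on \<open>\<I>(f)\<close> occur, and then \<open>\<partial>\<^sup>\<alpha>\<close> in the directions \<open>t\<^bsub>jl\<^esub>\<close> picks out
  \<open>\<alpha>! b\<^sub>\<alpha>\<close>.  So the remaining condition says that \<open>b\<^sub>\<alpha>\<close> is annihilated by the kernel of \<open>\<pi>\<^sub>\<alpha>\<close>, that is,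
  \<open>b\<^sub>\<alpha>\<close> is the pullback along \<open>\<pi>\<^sub>\<alpha>\<close> of its restriction to the tangent space of \<open>f\<close>.
\<close>


section \<open>Barycentric coordinates\<close>

text \<open>Geometrically, \<pi>_\<alpha> is the linear part of the affine map that fixes
  \<open>f\<close> and sends every vertex x_l outside \<open>f\<close> to p_\<alpha>, the point of
  \<open>f\<close> with barycentric coordinates \<alpha>_i / r; the vector from x_l to p_\<alpha> is
  t_{\<alpha> l}. This explains the ratio \<alpha>_i / |\<alpha>| in \<psi>_i: since these weights
  sum to 1, the \<psi>_i add up to 0, the relation that the d\<lambda>_i satisfy on
  \<open>f\<close>. The forms \<lambda>^\<alpha> d\<lambda>_\<sigma> satisfy relations while the
  operator is given by a definite description, so existence and uniqueness are separate tasks.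
  Coefficients kept as whole alternating maps, not expanded in the d\<lambda>_\<sigma>, are free of
  relations and give existence; an expansion that omits one index gives uniqueness. One mechanism
  serves both the uniqueness of coefficients and the description of vanishing: the derivative along
  an edge x_a - x_b relates the coefficients at \<gamma> + e_a and \<gamma> + e_b, so exponents can
  be moved from \<open>a\<close> to \<open>b\<close>.\<close>

lemma dir_deriv_eq:
  assumes S: "convex S" and y: "y \<in> S" and G: "(G has_derivative D) (at y)"
    and u: "\<And>z. z \<in> S \<Longrightarrow> u z = G z" and v: "v \<in> tangent S"
  shows "dir_deriv S v u y = D v"
proof -
  define F where "F = frechet_derivative u (at y within S)"
  have uD: "(u has_derivative D) (at y within S)"
    using has_derivative_transform[OF y u has_derivative_at_withinI[OF G]] .
  have uF: "(u has_derivative F) (at y within S)"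
    using uD unfolding F_def by (metis differentiableI frechet_derivative_works)
  have lin: "linear F" "linear D"
    using uF uD has_derivative_linear by blast+
  \<comment> \<open>When \<open>S\<close> has empty interior, a derivative within \<open>S\<close>
    need not be unique as a map on the whole space. Along the segment from \<open>y\<close> to
    \<open>z\<close> it is, by uniqueness of one-sided derivatives, and differences of the vectors
    \<open>z - y\<close> generate \<open>tangent S\<close>.\<close>
  have eq: "F (z - y) = D (z - y)" if z: "z \<in> S" for z
  proof -
    define g where "g = (\<lambda>t::real. y + t *\<^sub>R (z - y))"
    have img: "g ` {0..1} \<subseteq> S"
    proof
      fix w assume "w \<in> g ` {0..1}"
      then obtain t where t: "t \<in> {0..1}" "w = y + t *\<^sub>R (z - y)" by (auto simp: g_def)
      have "w = (1 - t) *\<^sub>R y + t *\<^sub>R z" using t by (simp add: algebra_simps)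
      then show "w \<in> S" using convexD_alt[OF S y z, of t] t by auto
    qed
    have g: "(g has_derivative (\<lambda>t. t *\<^sub>R (z - y))) (at 0 within {0..1})"
      unfolding g_def by (auto intro!: derivative_eq_intros)
    have g0: "g 0 = y" by (simp add: g_def)
    have comp: "((\<lambda>t. u (g t)) has_derivative (\<lambda>t. D' (t *\<^sub>R (z - y)))) (at 0 within {0..1})"
      if "(u has_derivative D') (at y within S)" for D'
    proof -
      have "(u has_derivative D') (at (g 0) within g ` {0..1})"
        unfolding g0 using has_derivative_subset[OF that img] .
      from has_derivative_in_compose[OF g this] show ?thesis .
    qed
    have "((\<lambda>t. u (g t)) has_vector_derivative F (z - y)) (at 0 within {0..1})"
      using comp[OF uF] unfolding has_vector_derivative_def by (simp add: linear_scale[OF lin(1)])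
    moreover have "((\<lambda>t. u (g t)) has_vector_derivative D (z - y)) (at 0 within {0..1})"
      using comp[OF uD] unfolding has_vector_derivative_def by (simp add: linear_scale[OF lin(2)])
    ultimately show ?thesis
      using vector_derivative_unique_within_closed_interval[of 0 1 0] by auto
  qed
  have "F v = D v"
  proof (rule linear_eq_on[OF lin v[unfolded tangent_def]])
    fix w assume "w \<in> {a - b |a b. a \<in> S \<and> b \<in> S}"
    then obtain a b where ab: "a \<in> S" "b \<in> S" "w = a - b" by auto
    have w: "w = (a - y) - (b - y)" using ab by simp
    show "F w = D w"
      unfolding w using eq ab by (simp only: linear_diff[OF lin(1)] linear_diff[OF lin(2)])
  qed
  then show ?thesis by (simp add: dir_deriv_def F_def)
qed

lemma tangent_zero: "0 \<in> tangent S"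
  and tangent_add: "u \<in> tangent S \<Longrightarrow> v \<in> tangent S \<Longrightarrow> u + v \<in> tangent S"
  and tangent_scale: "u \<in> tangent S \<Longrightarrow> c *\<^sub>R u \<in> tangent S"
  by (simp_all add: tangent_def span_zero span_add span_scale)

locale nondegenerate_simplex =
  fixes x :: "nat \<Rightarrow> real ^ 'n" and N :: "nat set"
  assumes is_simplex: "is_simplex x" and N_eq: "N = {..CARD('n)}"
begin

lemma finite_N [simp]: "finite N"
  by (simp add: N_eq)

definition face :: "nat set \<Rightarrow> (real ^ 'n) set" where
  "face A = convex hull (x ` A)"

text \<open>
  For \<open>i \<in> N\<close>, \<open>lam i\<close> is the extension of \<open>\<lambda>\<^sub>i\<^sup>T\<close> to an affine function on the whole space and
  \<open>dlam i\<close> is its linear part.  It is pinned down by the edges at \<open>x\<^sub>i\<close>; for \<open>i \<notin> N\<close> the choice is junk.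
\<close>

definition dlam :: "nat \<Rightarrow> real ^ 'n \<Rightarrow> real" where
  "dlam i = (SOME g. linear g \<and> (\<forall>j\<in>N - {i}. g (x j - x i) = -1))"

definition lam :: "nat \<Rightarrow> real ^ 'n \<Rightarrow> real" where
  "lam i y = 1 + dlam i (y - x i)"

lemma inj_x: "inj_on x N" and indep_x: "\<not> affine_dependent (x ` N)"
  using is_simplex by (auto simp: is_simplex_def N_eq)

lemma dlam_spec:
  assumes "i \<in> N"
  shows "linear (dlam i) \<and> (\<forall>j\<in>N - {i}. dlam i (x j - x i) = -1)"
proof -
  have "independent ((\<lambda>z. - x i + z) ` (x ` N - {x i}))"
    using affine_dependent_iff_dependent2[of "x i" "x ` N"] indep_x assms by auto
  then obtain g where g: "linear g"
    "\<forall>z\<in>(\<lambda>z. - x i + z) ` (x ` N - {x i}). g z = (-1::real)"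
    using linear_independent_extend[of _ "\<lambda>_. -1::real"] by blast
  have "g (x j - x i) = -1" if "j \<in> N - {i}" for j
  proof -
    have "x j \<noteq> x i" using that assms inj_x by (auto dest: inj_onD)
    then have "- x i + x j \<in> (\<lambda>z. - x i + z) ` (x ` N - {x i})" using that by blast
    then show ?thesis using g(2) by force
  qed
  with g(1) have "linear g \<and> (\<forall>j\<in>N - {i}. g (x j - x i) = -1)" by blast
  then show ?thesis 
    unfolding dlam_def by (rule someI[where P = "\<lambda>g. linear g \<and> (\<forall>j\<in>N - {i}. g (x j - x i) = -1)"])
qed

lemma linear_dlam: "i \<in> N \<Longrightarrow> linear (dlam i)"
  using dlam_spec by blast

lemma lam_add: "i \<in> N \<Longrightarrow> lam i (y + v) = lam i y + dlam i v"
  using linear_add[OF linear_dlam, of i "y - x i" v] by (simp add: lam_def add_diff_eq add.commute)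

lemma lam_diff: "i \<in> N \<Longrightarrow> lam i y - lam i z = dlam i (y - z)"
  using lam_add[of i z "y - z"] by simp

lemma lam_vertex: "i \<in> N \<Longrightarrow> j \<in> N \<Longrightarrow> lam i (x j) = (if i = j then 1 else 0)"
  using dlam_spec[of i] linear_0[of "dlam i"] by (auto simp: lam_def)

lemma dlam_edge:
  "i \<in> N \<Longrightarrow> a \<in> N \<Longrightarrow> b \<in> N \<Longrightarrow>
    dlam i (x a - x b) = (if i = a then 1 else 0) - (if i = b then 1 else 0)"
  using lam_diff[of i "x a" "x b"] by (simp add: lam_vertex)

lemma lam_affine_sum:
  assumes "i \<in> N" "finite A" "sum u A = 1"
  shows "lam i (\<Sum>j\<in>A. u j *\<^sub>R z j) = (\<Sum>j\<in>A. u j * lam i (z j))"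
proof -
  have L: "linear (dlam i)" using assms by (simp add: linear_dlam)
  have "(\<Sum>j\<in>A. u j *\<^sub>R z j) - x i = (\<Sum>j\<in>A. u j *\<^sub>R (z j - x i))"
    using assms(3) by (simp add: scaleR_diff_right sum_subtractf flip: scaleR_sum_left)
  then have "lam i (\<Sum>j\<in>A. u j *\<^sub>R z j) = 1 + (\<Sum>j\<in>A. u j * dlam i (z j - x i))"
    by (simp add: lam_def linear_sum[OF L] linear_scale[OF L])
  also have "\<dots> = (\<Sum>j\<in>A. u j * lam i (z j))"
    using assms(3) by (simp add: lam_def distrib_left sum.distrib)
  finally show ?thesis .
qed

text \<open>By dimension, the vertices affinely span the whole space, and \<open>lam i\<close> reads
  off the i-th coefficient of any affine combination of them.\<close>

lemma lam_decomposition: "(\<Sum>i\<in>N. lam i y) = 1 \<and> (\<Sum>i\<in>N. lam i y *\<^sub>R x i) = y"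
proof -
  have "card (x ` N) = CARD('n) + 1" using inj_x by (simp add: card_image N_eq)
  then have "aff_dim (x ` N) = DIM(real ^ 'n)"
    using aff_dim_affine_independent[OF indep_x] by simp
  then have "y \<in> affine hull (x ` N)" using aff_dim_eq_full by blast
  then obtain u where u: "sum u (x ` N) = 1" "(\<Sum>v\<in>x ` N. u v *\<^sub>R v) = y"
    by (auto simp: affine_hull_finite)
  have u': "(\<Sum>j\<in>N. u (x j)) = 1" "(\<Sum>j\<in>N. u (x j) *\<^sub>R x j) = y"
    using u inj_x by (simp_all add: sum.reindex)
  have "lam i y = u (x i)" if "i \<in> N" for i
  proof -
    have "lam i y = (\<Sum>j\<in>N. u (x j) * lam i (x j))"
      using lam_affine_sum[OF that _ u'(1), of x] u'(2) by simp
    also have "\<dots> = (\<Sum>j\<in>N. if i = j then u (x j) else 0)"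
      using that by (intro sum.cong) (auto simp: lam_vertex)
    finally show ?thesis using that by simp
  qed
  then show ?thesis using u' by simp
qed

lemma sum_lam: "(\<Sum>i\<in>N. lam i y) = 1" and sum_lam_x: "(\<Sum>i\<in>N. lam i y *\<^sub>R x i) = y"
  using lam_decomposition by blast+

lemma sum_dlam: "(\<Sum>i\<in>N. dlam i v) = 0" and sum_dlam_x: "(\<Sum>i\<in>N. dlam i v *\<^sub>R x i) = v"
proof -
  have *: "dlam i v = lam i v - lam i 0" if "i \<in> N" for i using lam_diff[OF that, of v 0] by simp
  show "(\<Sum>i\<in>N. dlam i v) = 0" using sum_lam by (simp add: * sum_subtractf)
  have "(\<Sum>i\<in>N. dlam i v *\<^sub>R x i) = (\<Sum>i\<in>N. lam i v *\<^sub>R x i) - (\<Sum>i\<in>N. lam i 0 *\<^sub>R x i)"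
    by (simp add: * scaleR_diff_left sum_subtractf)
  then show "(\<Sum>i\<in>N. dlam i v *\<^sub>R x i) = v" by (simp add: sum_lam_x)
qed

text \<open>Coefficients with sum 0 allow all points to be shifted by \<open>- x i\<close>. As
  \<open>dlam i\<close> is -1 on every edge leaving \<open>x i\<close>, the value is minus the sum
  of the remaining coefficients.\<close>

lemma dlam_eq_on_sum:
  assumes "i \<in> N" "A \<subseteq> N" "sum c A = 0"
  shows "dlam i (\<Sum>j\<in>A. c j *\<^sub>R x j) = (if i \<in> A then c i else 0)"
proof -
  have fin: "finite A" using finite_subset[OF assms(2)] by simp
  have L: "linear (dlam i)" using assms by (simp add: linear_dlam)
  have "(\<Sum>j\<in>A. c j *\<^sub>R x j) = (\<Sum>j\<in>A. c j *\<^sub>R (x j - x i))"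
    using assms(3) by (simp add: scaleR_diff_right sum_subtractf flip: scaleR_sum_left)
  then have "dlam i (\<Sum>j\<in>A. c j *\<^sub>R x j) = (\<Sum>j\<in>A. c j * dlam i (x j - x i))"
    by (simp add: linear_sum[OF L] linear_scale[OF L])
  also have "\<dots> = (\<Sum>j\<in>A. (if i = j then c j else 0) - c j)"
    using assms by (intro sum.cong refl) (auto simp: dlam_edge subset_iff)
  also have "\<dots> = (if i \<in> A then c i else 0)"
    using assms fin by (simp add: sum_subtractf)
  finally show ?thesis .
qed

section \<open>Faces, their tangent spaces and their barycentric coordinates\<close>

lemma convex_face: "convex (face A)"
  by (simp add: face_def)

lemma vertex_in_face: "i \<in> A \<Longrightarrow> x i \<in> face A"
  by (simp add: face_def hull_inc)

lemma face_mono: "A \<subseteq> B \<Longrightarrow> face A \<subseteq> face B"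
  by (simp add: face_def hull_mono image_mono)

lemma simplex_of_eq: "simplex_of x = face N"
  by (simp add: simplex_of_def face_def N_eq)

lemma lam_face_zero:
  assumes "A \<subseteq> N" "i \<in> N - A" "y \<in> face A"
  shows "lam i y = 0"
proof -
  have "convex {z. lam i z = 0}"
  proof (rule convexI)
    fix a b and u v :: real
    assume "a \<in> {z. lam i z = 0}" "b \<in> {z. lam i z = 0}" and uv: "u + v = 1"
    then have ab: "lam i a = 0" "lam i b = 0" by auto
    have i: "i \<in> N" using assms by auto
    have "u *\<^sub>R a + v *\<^sub>R b = a + v *\<^sub>R (b - a)"
      using uv by (simp add: algebra_simps flip: scaleR_add_left)
    then show "u *\<^sub>R a + v *\<^sub>R b \<in> {z. lam i z = 0}"
      using i ab lam_diff[OF i, of b a] by (simp add: lam_add linear_scale linear_dlam)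
  qed
  moreover have "x ` A \<subseteq> {z. lam i z = 0}" using assms by (auto simp: lam_vertex subset_iff)
  ultimately have "face A \<subseteq> {z. lam i z = 0}" unfolding face_def by (rule hull_minimal[rotated])
  then show ?thesis using assms by auto
qed

lemma sum_lam_face:
  assumes "A \<subseteq> N" "y \<in> face A"
  shows "(\<Sum>i\<in>A. lam i y) = 1" "(\<Sum>i\<in>A. lam i y *\<^sub>R x i) = y"
proof -
  have "(\<Sum>i\<in>A. lam i y) = (\<Sum>i\<in>N. lam i y)"
    using assms lam_face_zero by (intro sum.mono_neutral_left) auto
  then show "(\<Sum>i\<in>A. lam i y) = 1" by (simp add: sum_lam)
  have "(\<Sum>i\<in>A. lam i y *\<^sub>R x i) = (\<Sum>i\<in>N. lam i y *\<^sub>R x i)"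
    using assms lam_face_zero by (intro sum.mono_neutral_left) auto
  then show "(\<Sum>i\<in>A. lam i y *\<^sub>R x i) = y" by (simp add: sum_lam_x)
qed

lemma vanishing_off_face:
  assumes A: "A \<subseteq> N" and v: "\<forall>i\<in>N - A. dlam i v = 0"
  shows "(\<Sum>i\<in>A. dlam i v) = 0" "(\<Sum>i\<in>A. dlam i v *\<^sub>R x i) = v"
  using A v sum_dlam[of v] sum_dlam_x[of v] sum.mono_neutral_left[of N A "\<lambda>i. dlam i v"]
    sum.mono_neutral_left[of N A "\<lambda>i. dlam i v *\<^sub>R x i"]
  by simp_all

lemma vanishing_off_face_in_span:
  assumes A: "A \<subseteq> N" and b: "b \<in> A" and v: "\<forall>i\<in>N - A. dlam i v = 0"
  shows "v \<in> span ((\<lambda>i. x i - x b) ` (A - {b}))"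
proof -
  have "finite A" using A finite_subset by (metis finite_N)
  have "v = (\<Sum>i\<in>A. dlam i v *\<^sub>R x i)" using vanishing_off_face(2)[OF A v] by simp
  also have "\<dots> = (\<Sum>i\<in>A. dlam i v *\<^sub>R (x i - x b))"
    using vanishing_off_face(1)[OF A v]
    by (simp add: scaleR_diff_right sum_subtractf flip: scaleR_sum_left)
  also have "\<dots> = (\<Sum>i\<in>A - {b}. dlam i v *\<^sub>R (x i - x b))"
    using \<open>finite A\<close> b by (simp add: sum.remove[of A b])
  also have "\<dots> \<in> span ((\<lambda>i. x i - x b) ` (A - {b}))"
    by (intro span_sum span_scale span_base) auto
  finally show ?thesis .
qed

lemma edge_in_tangent: "a \<in> A \<Longrightarrow> b \<in> A \<Longrightarrow> x a - x b \<in> tangent (face A)"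
  unfolding tangent_def using vertex_in_face by (intro span_base) blast

text \<open>Replaces membership in a span by linear equations, the form in which the projections
  onto a face are checked. For \<open>A = N\<close> there is no equation and every vector is
  tangent.\<close>

lemma tangent_face:
  assumes "A \<subseteq> N" "A \<noteq> {}"
  shows "tangent (face A) = {v. \<forall>i\<in>N - A. dlam i v = 0}"
proof (intro equalityI subsetI CollectI ballI)
  fix v i assume v: "v \<in> tangent (face A)" and i: "i \<in> N - A"
  have L: "linear (dlam i)" using i by (simp add: linear_dlam)
  show "dlam i v = 0"
  proof (rule linear_eq_0_on_span[OF L _ v[unfolded tangent_def]])
    fix w assume "w \<in> {a - b |a b. a \<in> face A \<and> b \<in> face A}"
    then show "dlam i w = 0"
      using i lam_face_zero[OF assms(1) i] by (auto simp flip: lam_diff)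
  qed
next
  fix v assume v: "v \<in> {v. \<forall>i\<in>N - A. dlam i v = 0}"
  obtain b where b: "b \<in> A" using assms by auto
  have "v \<in> span ((\<lambda>i. x i - x b) ` (A - {b}))"
    using v by (intro vanishing_off_face_in_span assms(1) b) simp
  also have "\<dots> \<subseteq> tangent (face A)"
    using edge_in_tangent[OF _ b] unfolding tangent_def by (intro span_minimal) auto
  finally show "v \<in> tangent (face A)" .
qed

lemma tangent_face_N: "tangent (face N) = UNIV"
  by (subst tangent_face) (auto simp: N_eq)

text \<open>Indices are defined through extreme points; affine independence ensures that these are
  exactly the spanning vertices, so the index set is recovered from the point set.\<close>

lemma indices_face:
  assumes "A \<subseteq> N"
  shows "indices x (face A) = A"
proof -
  have "\<not> affine_dependent (x ` A)"
    using affine_independent_subset[OF indep_x] assms by (simp add: image_mono)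
  then show ?thesis
    using assms inj_x
    by (auto simp: indices_def face_def N_eq extreme_point_of_convex_hull_affine_independent
        dest!: inj_onD)
qed

lemma bary_face:
  assumes A: "A \<subseteq> N" and i: "i \<in> A"
  shows "bary x (face A) i = (\<lambda>y. if y \<in> face A then lam i y else 0)"
  unfolding bary_def indices_face[OF A]
proof (rule the_equality)
  have iN: "i \<in> N" using A i by auto
  have comb: "lam i ((1 - t) *\<^sub>R a + t *\<^sub>R b) = (1 - t) * lam i a + t * lam i b" for a b t
  proof -
    have "(1 - t) *\<^sub>R a + t *\<^sub>R b = a + t *\<^sub>R (b - a)" by (simp add: algebra_simps)
    then have "lam i ((1 - t) *\<^sub>R a + t *\<^sub>R b) = lam i a + t * (lam i b - lam i a)"
      by (simp only: lam_add[OF iN] linear_scale[OF linear_dlam[OF iN]] lam_diff[OF iN] real_scaleR_def)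
    then show ?thesis by (simp add: algebra_simps)
  qed
  show "affine_fun_on (face A) (\<lambda>y. if y \<in> face A then lam i y else 0) \<and>
    (\<forall>j\<in>A. (if x j \<in> face A then lam i (x j) else 0) = (if i = j then 1 else 0)) \<and>
    (\<forall>y. y \<notin> face A \<longrightarrow> (if y \<in> face A then lam i y else 0) = 0)"
    using A iN convexD_alt[OF convex_face[of A]]
    by (simp add: affine_fun_on_def vertex_in_face lam_vertex subset_iff comb)
  fix u
  assume u: "affine_fun_on (face A) u \<and> (\<forall>j\<in>A. u (x j) = (if i = j then 1 else 0)) \<and>
    (\<forall>y. y \<notin> face A \<longrightarrow> u y = 0)"
  \<comment> \<open>An affine function is determined by its vertex values: the set of agreement is
    convex and contains the vertices, hence the whole face.\<close>
  have "convex {y \<in> face A. u y = lam i y}"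
    unfolding convex_alt using u convexD_alt[OF convex_face[of A]]
    by (simp add: affine_fun_on_def comb)
  moreover have "x ` A \<subseteq> {y \<in> face A. u y = lam i y}"
    using u A iN by (auto simp: vertex_in_face lam_vertex subset_iff)
  ultimately have "face A \<subseteq> {y \<in> face A. u y = lam i y}"
    by (subst face_def) (rule hull_minimal[rotated])
  then show "u = (\<lambda>y. if y \<in> face A then lam i y else 0)"
    using u by (auto simp: fun_eq_iff)
qed

lemma has_derivative_lam: "i \<in> N \<Longrightarrow> (lam i has_derivative dlam i) (at y)"
proof -
  assume i: "i \<in> N"
  have "((\<lambda>y. 1 + dlam i (y - x i)) has_derivative (\<lambda>v. 0 + dlam i (v - 0))) (at y)"
    by (intro derivative_intros
        has_derivative_compose[OF _ linear_imp_has_derivative[OF linear_dlam[OF i]]])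
  then show ?thesis unfolding lam_def[abs_def] by simp
qed

lemma d_bary_face:
  assumes "A \<subseteq> N" "i \<in> A" "y \<in> face A" "v \<in> tangent (face A)"
  shows "d_bary x (face A) i y v = dlam i v"
  unfolding d_bary_def
  by (rule dir_deriv_eq[OF convex_face assms(3) has_derivative_lam _ assms(4)])
    (use assms in \<open>auto simp: bary_face\<close>)

end

lemma faces_eq:
  fixes x :: "nat \<Rightarrow> real ^ 'n"
  assumes "is_simplex x" "f \<in> faces x"
  obtains I where "I \<subseteq> {..CARD('n)}" "I \<noteq> {}" "f = convex hull (x ` I)"
proof -
  have "\<not> affine_dependent (x ` {..CARD('n)})" using assms by (simp add: is_simplex_def)
  moreover have "f face_of convex hull (x ` {..CARD('n)})" "f \<noteq> {}"
    using assms by (auto simp: faces_def simplex_of_def)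
  ultimately obtain c where c: "c \<subseteq> x ` {..CARD('n)}" "f = convex hull c"
    using face_of_convex_hull_affine_independent by blast
  then obtain I where "I \<subseteq> {..CARD('n)}" "c = x ` I" by (auto simp: subset_image_iff)
  then show thesis using that[of I] c \<open>f \<noteq> {}\<close> by (cases "I = {}") simp_all
qed


section \<open>Bernstein polynomials\<close>

lemma finite_multi_indices:
  assumes "finite A"
  shows "finite (multi_indices A r)"
proof (rule finite_subset)
  show "multi_indices A r \<subseteq> {\<alpha>. \<forall>i. (i \<in> A \<longrightarrow> \<alpha> i \<in> {..r}) \<and> (i \<notin> A \<longrightarrow> \<alpha> i = 0)}"
    using assms member_le_sum[of _ A] by (fastforce simp: multi_indices_def)
  show "finite {\<alpha>. \<forall>i. (i \<in> A \<longrightarrow> \<alpha> i \<in> {..r}) \<and> (i \<notin> A \<longrightarrow> \<alpha> i = 0)}"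
    using assms by (intro finite_set_of_finite_funs) auto
qed

lemma multi_indices_0: "finite A \<Longrightarrow> multi_indices A 0 = {\<lambda>_. 0}"
  by (auto simp: multi_indices_def fun_eq_iff)

lemma sum_incr:
  fixes \<gamma> :: "'a \<Rightarrow> nat"
  assumes "finite A"
  shows "sum (\<gamma>(i := Suc (\<gamma> i))) A = sum \<gamma> A + (if i \<in> A then 1 else 0)"
proof (cases "i \<in> A")
  case True
  have "sum (\<gamma>(i := Suc (\<gamma> i))) (A - {i}) = sum \<gamma> (A - {i})" by (intro sum.cong) auto
  then show ?thesis using True assms by (simp add: sum.remove[of A i])
next
  case False
  then show ?thesis by (auto intro!: sum.cong)
qed

lemma multi_indices_incr:
  assumes "finite A" "i \<in> A" "\<gamma> \<in> multi_indices A r"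
  shows "\<gamma>(i := Suc (\<gamma> i)) \<in> multi_indices A (Suc r)"
  using assms by (auto simp: multi_indices_def sum_incr simp del: fun_upd_apply)
    (auto simp: multi_indices_def)

lemma multi_indices_decr:
  assumes "finite A" "i \<in> A" "\<beta> \<in> multi_indices A (Suc r)" "\<beta> i > 0"
  shows "\<beta>(i := \<beta> i - 1) \<in> multi_indices A r"
proof -
  define \<gamma> where "\<gamma> = \<beta>(i := \<beta> i - 1)"
  have "\<beta> = \<gamma>(i := Suc (\<gamma> i))" using assms by (auto simp: \<gamma>_def)
  moreover have "\<forall>j. j \<notin> A \<longrightarrow> \<gamma> j = 0" using assms by (auto simp: \<gamma>_def multi_indices_def)
  ultimately show ?thesis
    using assms(1-3) sum_incr[OF assms(1), of \<gamma> i] unfolding \<gamma>_def[symmetric]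
    by (simp add: multi_indices_def)
qed

lemma sum_multi_indices_incr:
  assumes "finite A" "i \<in> A"
  shows "(\<Sum>\<beta> | \<beta> \<in> multi_indices A (Suc r) \<and> \<beta> i > 0. g \<beta>)
    = (\<Sum>\<gamma>\<in>multi_indices A r. g (\<gamma>(i := Suc (\<gamma> i))))"
  using assms
  by (intro sum.reindex_bij_witness[of _ "\<lambda>\<gamma>. \<gamma>(i := Suc (\<gamma> i))" "\<lambda>\<beta>. \<beta>(i := \<beta> i - 1)"])
    (auto intro: multi_indices_incr multi_indices_decr[unfolded One_nat_def])

text \<open>Relations that move exponents from \<open>B\<close> to the index \<open>b\<close> reduce every coefficient to those supported off \<open>B\<close>.\<close>

lemma vanishing_by_transfer:
  fixes c :: "('a \<Rightarrow> nat) \<Rightarrow> real"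
  assumes fin: "finite B" and b: "b \<notin> B"
    and base: "\<And>\<beta>. \<beta> \<in> S \<Longrightarrow> \<forall>i\<in>B. \<beta> i = 0 \<Longrightarrow> c \<beta> = 0"
    and step: "\<And>\<beta> a. \<beta> \<in> S \<Longrightarrow> a \<in> B \<Longrightarrow> \<beta> a > 0 \<Longrightarrow>
      \<beta>(a := \<beta> a - 1, b := Suc (\<beta> b)) \<in> S \<and>
      (c (\<beta>(a := \<beta> a - 1, b := Suc (\<beta> b))) = 0 \<longrightarrow> c \<beta> = 0)"
    and "\<beta> \<in> S"
  shows "c \<beta> = 0"
  using \<open>\<beta> \<in> S\<close>
proof (induction "sum \<beta> B" arbitrary: \<beta> rule: less_induct)
  case less
  show ?case
  proof (cases "\<forall>i\<in>B. \<beta> i = 0")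
    case True
    then show ?thesis using base less.prems by blast
  next
    case False
    then obtain a where a: "a \<in> B" "\<beta> a > 0" by auto
    let ?\<beta> = "\<beta>(a := \<beta> a - 1, b := Suc (\<beta> b))"
    have "sum ?\<beta> B < sum \<beta> B"
      using a b fin by (intro sum_strict_mono_ex1) auto
    then show ?thesis using less.hyps[of ?\<beta>] step[OF less.prems a] by blast
  qed
qed

section \<open>Polynomials in Cartesian coordinates\<close>

lemma finite_exponents: "finite {m :: 'n::finite \<Rightarrow> nat. sum m UNIV \<le> r}"
proof -
  have "{m :: 'n \<Rightarrow> nat. sum m UNIV \<le> r} \<subseteq> (\<Union>s\<le>r. {m. sum m UNIV = s})" by auto
  moreover have "finite {m :: 'n \<Rightarrow> nat. sum m UNIV = s}" for s
  proof (rule finite_subset)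
    show "{m :: 'n \<Rightarrow> nat. sum m UNIV = s} \<subseteq> UNIV \<rightarrow>\<^sub>E {..s}"
      by (auto simp: PiE_iff extensional_def intro!: member_le_sum)
  qed (simp add: finite_PiE)
  ultimately show ?thesis using finite_subset by blast
qed

lemma poly_fun_add: "poly_fun r p \<Longrightarrow> poly_fun r q \<Longrightarrow> poly_fun r (\<lambda>y. p y + q y)"
proof -
  assume p: "poly_fun r p" and q: "poly_fun r q"
  obtain c where "\<And>y. p y = (\<Sum>m \<in> {m. sum m UNIV \<le> r}. c m * (\<Prod>i\<in>UNIV. (y $ i) ^ m i))"
    using p unfolding poly_fun_def by blast
  moreover obtain d where
    "\<And>y. q y = (\<Sum>m \<in> {m. sum m UNIV \<le> r}. d m * (\<Prod>i\<in>UNIV. (y $ i) ^ m i))"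
    using q unfolding poly_fun_def by blast
  ultimately show ?thesis
    unfolding poly_fun_def by (intro exI[of _ "\<lambda>m. c m + d m"]) (simp add: distrib_right sum.distrib)
qed

lemma poly_fun_cmult: "poly_fun r p \<Longrightarrow> poly_fun r (\<lambda>y. a * p y)"
proof -
  assume "poly_fun r p"
  then obtain c where
    "\<And>y. p y = (\<Sum>m \<in> {m. sum m UNIV \<le> r}. c m * (\<Prod>i\<in>UNIV. (y $ i) ^ m i))"
    unfolding poly_fun_def by blast
  then show ?thesis
    unfolding poly_fun_def
    by (intro exI[of _ "\<lambda>m. a * c m"]) (simp add: sum_distrib_left mult.assoc)
qed

lemma poly_fun_0: "poly_fun r (\<lambda>y. 0)"
  unfolding poly_fun_def by (intro exI[of _ "\<lambda>m. 0"]) simp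

lemma poly_fun_sum: "(\<And>i. i \<in> A \<Longrightarrow> poly_fun r (p i)) \<Longrightarrow> poly_fun r (\<lambda>y. \<Sum>i\<in>A. p i y)"
  by (induction A rule: infinite_finite_induct) (auto intro: poly_fun_0 poly_fun_add)

lemma poly_fun_1: "poly_fun 0 (\<lambda>y :: real ^ 'n. 1)"
proof -
  have "{m :: 'n \<Rightarrow> nat. sum m UNIV \<le> 0} = {\<lambda>_. 0}"
    by (auto simp: fun_eq_iff sum_eq_0_iff)
  then show ?thesis unfolding poly_fun_def by (intro exI[of _ "\<lambda>m. 1"]) simp
qed

lemma poly_fun_Suc: "poly_fun r p \<Longrightarrow> poly_fun (Suc r) p"
proof -
  assume "poly_fun r p"
  then obtain c where c:
    "\<And>y. p y = (\<Sum>m \<in> {m. sum m UNIV \<le> r}. c m * (\<Prod>i\<in>UNIV. (y $ i) ^ m i))"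
    unfolding poly_fun_def by blast
  have "p y = (\<Sum>m \<in> {m. sum m UNIV \<le> Suc r}.
    (if sum m UNIV \<le> r then c m else 0) * (\<Prod>i\<in>UNIV. (y $ i) ^ m i))" for y
    unfolding c by (rule sum.mono_neutral_cong_left) (auto simp: finite_exponents)
  then show ?thesis
    unfolding poly_fun_def by (intro exI[of _ "\<lambda>m. if sum m UNIV \<le> r then c m else 0"]) blast
qed

lemma poly_fun_coord_mult: "poly_fun r p \<Longrightarrow> poly_fun (Suc r) (\<lambda>y. y $ j * p y)"
proof -
  assume "poly_fun r p"
  then obtain c where c:
    "\<And>y. p y = (\<Sum>m \<in> {m. sum m UNIV \<le> r}. c m * (\<Prod>i\<in>UNIV. (y $ i) ^ m i))"
    unfolding poly_fun_def by blast
  \<comment> \<open>Multiplication by \<open>y $ j\<close> raises the exponent at \<open>j\<close>;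
    \<open>d\<close> undoes this shift and is 0 where there is nothing to lower.\<close>
  define d where "d m = (if m j > 0 then c (m(j := m j - 1)) else 0)" for m
  have incr: "sum (m(j := Suc (m j))) UNIV = Suc (sum m UNIV)" for m :: "'a \<Rightarrow> nat"
    by (simp add: sum_incr del: fun_upd_apply)
  have prod_incr: "(\<Prod>i\<in>UNIV. (y $ i) ^ (m(j := Suc (m j))) i) = y $ j * (\<Prod>i\<in>UNIV. (y $ i) ^ m i)"
    for y and m
    by (simp add: prod.remove[of UNIV j] mult.assoc)
  have "y $ j * p y = (\<Sum>m \<in> {m. sum m UNIV \<le> Suc r}. d m * (\<Prod>i\<in>UNIV. (y $ i) ^ m i))" for y
  proof -
    have "(\<Sum>m \<in> {m. sum m UNIV \<le> Suc r}. d m * (\<Prod>i\<in>UNIV. (y $ i) ^ m i))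
      = (\<Sum>m \<in> {m. sum m UNIV \<le> Suc r \<and> m j > 0}. d m * (\<Prod>i\<in>UNIV. (y $ i) ^ m i))"
      by (rule sum.mono_neutral_right) (auto simp: finite_exponents d_def)
    also have "\<dots> = (\<Sum>m \<in> {m. sum m UNIV \<le> r}.
        d (m(j := Suc (m j))) * (\<Prod>i\<in>UNIV. (y $ i) ^ (m(j := Suc (m j))) i))"
    proof (rule sum.reindex_bij_witness[of _ "\<lambda>m. m(j := Suc (m j))" "\<lambda>m. m(j := m j - 1)"])
      fix m assume m: "m \<in> {m. sum m UNIV \<le> Suc r \<and> m j > 0}"
      show "m(j := m j - 1) \<in> {m. sum m UNIV \<le> r}"
        using m incr[of "m(j := m j - 1)"] by simp
    qed (auto simp: incr simp del: fun_upd_apply, auto)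
    also have "\<dots> = y $ j * p y"
      unfolding c prod_incr sum_distrib_left by (intro sum.cong) (auto simp: d_def)
    finally show ?thesis by simp
  qed
  then show ?thesis unfolding poly_fun_def by (intro exI[of _ d]) blast
qed

section \<open>Bernstein polynomials on a face: derivatives and uniqueness of coefficients\<close>

context nondegenerate_simplex
begin

lemma finite_face_indices: "A \<subseteq> N \<Longrightarrow> finite A"
  using finite_subset finite_N by blast

definition bmono :: "(nat \<Rightarrow> nat) \<Rightarrow> real ^ 'n \<Rightarrow> real" where
  "bmono \<beta> y = (\<Prod>i\<in>N. lam i y ^ \<beta> i)"

definition bpoly :: "nat set \<Rightarrow> nat \<Rightarrow> ((nat \<Rightarrow> nat) \<Rightarrow> real) \<Rightarrow> real ^ 'n \<Rightarrow> real" where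
  "bpoly A r c y = (\<Sum>\<beta>\<in>multi_indices A r. c \<beta> * bmono \<beta> y)"

text \<open>The coefficients of the derivative in direction \<open>v\<close>: the term of \<beta>
  contributes to each \<gamma> = \<beta> - e_i with factor \<beta>_i = \<gamma>_i + 1. The monomials
  carry no multinomial normalisation, hence this factor.\<close>

definition dcoef :: "nat set \<Rightarrow> real ^ 'n \<Rightarrow> ((nat \<Rightarrow> nat) \<Rightarrow> real) \<Rightarrow> (nat \<Rightarrow> nat) \<Rightarrow> real" where
  "dcoef A v c \<gamma> = (\<Sum>i\<in>A. real (Suc (\<gamma> i)) * dlam i v * c (\<gamma>(i := Suc (\<gamma> i))))"

lemma bmono_incr: "i \<in> N \<Longrightarrow> bmono (\<beta>(i := Suc (\<beta> i))) y = lam i y * bmono \<beta> y"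
  by (simp add: bmono_def prod.remove[of N i] mult.assoc)

lemma bpoly_cong: "(\<And>\<beta>. \<beta> \<in> multi_indices A r \<Longrightarrow> c \<beta> = d \<beta>) \<Longrightarrow> bpoly A r c y = bpoly A r d y"
  by (simp add: bpoly_def)

lemma bpoly_add: "bpoly A r (\<lambda>\<beta>. c \<beta> + d \<beta>) y = bpoly A r c y + bpoly A r d y"
  by (simp add: bpoly_def distrib_right sum.distrib)

lemma bpoly_cmult: "bpoly A r (\<lambda>\<beta>. a * c \<beta>) y = a * bpoly A r c y"
  by (simp add: bpoly_def sum_distrib_left mult.assoc)

lemma bpoly_0: "bpoly A r (\<lambda>\<beta>. 0) y = 0"
  by (simp add: bpoly_def)

lemma bpoly_degree_0: "A \<subseteq> N \<Longrightarrow> bpoly A 0 c y = c (\<lambda>_. 0)"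
  by (simp add: bpoly_def multi_indices_0 finite_face_indices bmono_def)

text \<open>The truncated subtraction is harmless: where \<open>\<beta> i = 0\<close>, the factor
  \<open>real (\<beta> i)\<close> removes the term.\<close>

lemma has_derivative_bmono:
  "(bmono \<beta> has_derivative (\<lambda>v. \<Sum>i\<in>N. real (\<beta> i) * dlam i v * bmono (\<beta>(i := \<beta> i - 1)) y)) (at y)"
proof -
  have "((\<lambda>y. \<Prod>i\<in>N. lam i y ^ \<beta> i) has_derivative
    (\<lambda>v. \<Sum>i\<in>N. (real (\<beta> i) * dlam i v * lam i y ^ (\<beta> i - 1)) * (\<Prod>j\<in>N - {i}. lam j y ^ \<beta> j))) (at y)"
    by (intro has_derivative_prod has_derivative_power has_derivative_lam)
  moreover have "(real (\<beta> i) * dlam i v * lam i y ^ (\<beta> i - 1)) * (\<Prod>j\<in>N - {i}. lam j y ^ \<beta> j)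
    = real (\<beta> i) * dlam i v * bmono (\<beta>(i := \<beta> i - 1)) y" if "i \<in> N" for i v
  proof -
    have "(\<Prod>j\<in>N - {i}. lam j y ^ (\<beta>(i := \<beta> i - 1)) j) = (\<Prod>j\<in>N - {i}. lam j y ^ \<beta> j)"
      by (intro prod.cong) auto
    then show ?thesis using that by (simp add: bmono_def prod.remove[of N i])
  qed
  moreover have bm: "bmono \<beta> = (\<lambda>y. \<Prod>i\<in>N. lam i y ^ \<beta> i)" by (simp add: fun_eq_iff bmono_def)
  ultimately show ?thesis by (simp only: bm cong: sum.cong)
qed

lemma has_derivative_bpoly:
  assumes A: "A \<subseteq> N"
  shows "(bpoly A (Suc r) c has_derivative (\<lambda>v. bpoly A r (dcoef A v c) y)) (at y)"
proof -
  let ?M = "multi_indices A (Suc r)"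
  have fin: "finite A" "finite ?M"
    using A by (simp_all add: finite_face_indices finite_multi_indices)
  have "((\<lambda>y. \<Sum>\<beta>\<in>?M. c \<beta> * bmono \<beta> y) has_derivative
    (\<lambda>v. \<Sum>\<beta>\<in>?M. c \<beta> * (\<Sum>i\<in>N. real (\<beta> i) * dlam i v * bmono (\<beta>(i := \<beta> i - 1)) y))) (at y)"
    by (intro has_derivative_sum has_derivative_mult_right has_derivative_bmono)
  moreover have "(\<Sum>\<beta>\<in>?M. c \<beta> * (\<Sum>i\<in>N. real (\<beta> i) * dlam i v * bmono (\<beta>(i := \<beta> i - 1)) y))
    = bpoly A r (dcoef A v c) y" for v
  proof -
    have "(\<Sum>\<beta>\<in>?M. c \<beta> * (\<Sum>i\<in>N. real (\<beta> i) * dlam i v * bmono (\<beta>(i := \<beta> i - 1)) y))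
      = (\<Sum>\<beta>\<in>?M. \<Sum>i\<in>A. c \<beta> * (real (\<beta> i) * dlam i v * bmono (\<beta>(i := \<beta> i - 1)) y))"
    proof (rule sum.cong[OF refl])
      fix \<beta> assume "\<beta> \<in> ?M"
      then have "(\<Sum>i\<in>N. real (\<beta> i) * dlam i v * bmono (\<beta>(i := \<beta> i - 1)) y)
        = (\<Sum>i\<in>A. real (\<beta> i) * dlam i v * bmono (\<beta>(i := \<beta> i - 1)) y)"
        using A by (intro sum.mono_neutral_right) (auto simp: multi_indices_def)
      then show "c \<beta> * (\<Sum>i\<in>N. real (\<beta> i) * dlam i v * bmono (\<beta>(i := \<beta> i - 1)) y)
        = (\<Sum>i\<in>A. c \<beta> * (real (\<beta> i) * dlam i v * bmono (\<beta>(i := \<beta> i - 1)) y))"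
        by (simp only: sum_distrib_left)
    qed
    also have "\<dots> = (\<Sum>i\<in>A. \<Sum>\<beta>\<in>?M. c \<beta> * (real (\<beta> i) * dlam i v * bmono (\<beta>(i := \<beta> i - 1)) y))"
      by (rule sum.swap)
    also have "\<dots> = (\<Sum>i\<in>A. \<Sum>\<gamma>\<in>multi_indices A r.
        real (Suc (\<gamma> i)) * dlam i v * c (\<gamma>(i := Suc (\<gamma> i))) * bmono \<gamma> y)"
    proof (rule sum.cong[OF refl])
      fix i assume i: "i \<in> A"
      \<comment> \<open>Terms with \<open>\<beta> i = 0\<close> vanish; on the others, lowering the
        exponent at \<open>i\<close> is a bijection onto the multi-indices of degree
        \<open>r\<close>.\<close>
      have "(\<Sum>\<beta>\<in>?M. c \<beta> * (real (\<beta> i) * dlam i v * bmono (\<beta>(i := \<beta> i - 1)) y))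
        = (\<Sum>\<beta> | \<beta> \<in> ?M \<and> \<beta> i > 0. c \<beta> * (real (\<beta> i) * dlam i v * bmono (\<beta>(i := \<beta> i - 1)) y))"
        using fin by (intro sum.mono_neutral_right) auto
      then show "(\<Sum>\<beta>\<in>?M. c \<beta> * (real (\<beta> i) * dlam i v * bmono (\<beta>(i := \<beta> i - 1)) y))
        = (\<Sum>\<gamma>\<in>multi_indices A r.
          real (Suc (\<gamma> i)) * dlam i v * c (\<gamma>(i := Suc (\<gamma> i))) * bmono \<gamma> y)"
        unfolding sum_multi_indices_incr[OF fin(1) i]
        by (auto intro!: sum.cong simp: mult_ac)
    qed
    also have "\<dots> = bpoly A r (dcoef A v c) y"
      unfolding bpoly_def dcoef_def sum_distrib_right by (rule sum.swap)
    finally show ?thesis .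
  qed
  ultimately show ?thesis by (simp add: bpoly_def[abs_def])
qed

lemma dir_deriv_bpoly:
  assumes "A \<subseteq> N" "y \<in> face B" "v \<in> tangent (face B)"
    and "\<And>z. z \<in> face B \<Longrightarrow> u z = bpoly A (Suc r) c z"
  shows "dir_deriv (face B) v u y = bpoly A r (dcoef A v c) y"
  using dir_deriv_eq[OF convex_face assms(2) has_derivative_bpoly[OF assms(1)] assms(4,3)] by simp

text \<open>Along an edge only the coordinates of its two ends vary. If one end lies outside
  \<open>A\<close>, a single exponent shift survives; if both lie in \<open>A\<close>, a vanishing
  derivative is an exchange relation between two coefficients.\<close>

lemma dcoef_edge:
  assumes "A \<subseteq> N" "a \<in> N" "b \<in> N"
  shows "dcoef A (x a - x b) c \<gamma> =
    (if a \<in> A then real (Suc (\<gamma> a)) * c (\<gamma>(a := Suc (\<gamma> a))) else 0) -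
    (if b \<in> A then real (Suc (\<gamma> b)) * c (\<gamma>(b := Suc (\<gamma> b))) else 0)"
proof -
  have "dcoef A (x a - x b) c \<gamma> = (\<Sum>i\<in>A. (if i = a then real (Suc (\<gamma> i)) * c (\<gamma>(i := Suc (\<gamma> i))) else 0)
    - (if i = b then real (Suc (\<gamma> i)) * c (\<gamma>(i := Suc (\<gamma> i))) else 0))"
    unfolding dcoef_def using assms
    by (intro sum.cong refl) (auto simp: dlam_edge subset_iff algebra_simps)
  then show ?thesis using finite_face_indices[OF assms(1)]
    by (simp only: sum_subtractf sum.delta)
qed

lemma bmono_vertex:
  assumes "b \<in> N"
  shows "bmono \<beta> (x b) = (if \<forall>i\<in>N - {b}. \<beta> i = 0 then 1 else 0)"
proof (cases "\<forall>i\<in>N - {b}. \<beta> i = 0")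
  case True
  then show ?thesis using assms by (simp add: bmono_def lam_vertex prod.remove[of N b])
next
  case False
  then obtain i where i: "i \<in> N" "i \<noteq> b" "\<beta> i > 0" by auto
  then have "lam i (x b) ^ \<beta> i = 0" using assms by (simp add: lam_vertex)
  then show ?thesis unfolding bmono_def using i False prod_zero by (metis (no_types, lifting) finite_N)
qed

text \<open>Induction on the degree: derivatives along the edges at \<open>x b\<close> again vanish
  on the face, so the exchange relations let all exponents be moved to \<open>b\<close>. The one
  coefficient left, that of the r-th power of \<open>lam b\<close>, is the value at the vertex
  \<open>x b\<close>.\<close>

lemma bpoly_eq_0_imp:
  assumes A: "A \<subseteq> N" "A \<noteq> {}" and "\<And>y. y \<in> face A \<Longrightarrow> bpoly A r c y = 0"
    and "\<beta> \<in> multi_indices A r"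
  shows "c \<beta> = 0"
  using assms(3,4)
proof (induction r arbitrary: c \<beta>)
  case 0
  obtain a where a: "a \<in> A" using A by auto
  then show ?case
    using 0 A(1) vertex_in_face[OF a]
    by (simp add: bpoly_degree_0 multi_indices_0 finite_face_indices)
next
  case (Suc r)
  have fin: "finite A" using A by (simp add: finite_face_indices)
  obtain b where b: "b \<in> A" using A by auto
  have transfer: "real (Suc (\<gamma> a)) * c (\<gamma>(a := Suc (\<gamma> a))) = real (Suc (\<gamma> b)) * c (\<gamma>(b := Suc (\<gamma> b)))"
    if a: "a \<in> A" and \<gamma>: "\<gamma> \<in> multi_indices A r" for a \<gamma>
  proof -
    have v: "x a - x b \<in> tangent (face A)" using a b by (rule edge_in_tangent)
    have "dcoef A (x a - x b) c \<gamma> = 0"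
    proof (rule Suc.IH[OF _ \<gamma>])
      fix y assume y: "y \<in> face A"
      \<comment> \<open>The polynomial is known to vanish on the face only, which still fixes its
        derivative within the face in tangent directions.\<close>
      have "dir_deriv (face A) (x a - x b) (bpoly A (Suc r) c) y = 0"
        by (rule dir_deriv_eq[OF convex_face y has_derivative_const _ v]) (rule Suc.prems(1))
      then show "bpoly A r (dcoef A (x a - x b) c) y = 0"
        using dir_deriv_bpoly[OF A(1) y v, of "bpoly A (Suc r) c"] by simp
    qed
    then show ?thesis using a b A(1) by (simp add: dcoef_edge subset_iff)
  qed
  show ?case
  proof (rule vanishing_by_transfer[of "A - {b}" b "multi_indices A (Suc r)" c])
    show "\<beta> \<in> multi_indices A (Suc r)" by (rule Suc.prems(2))
  next
    fix \<beta> assume \<beta>: "\<beta> \<in> multi_indices A (Suc r)" and 0: "\<forall>i\<in>A - {b}. \<beta> i = 0"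
    have unique: "\<beta>' = \<beta>" if \<beta>': "\<beta>' \<in> multi_indices A (Suc r)" and z': "\<forall>i\<in>N - {b}. \<beta>' i = 0" for \<beta>'
    proof
      fix i
      have "\<forall>i\<in>A - {b}. \<beta>' i = 0" using z' A(1) by blast
      then have "\<beta> b = sum \<beta> A" "\<beta>' b = sum \<beta>' A"
        using 0 b fin by (simp_all add: sum.remove[of A b])
      then show "\<beta>' i = \<beta> i"
        using \<beta> \<beta>' 0 z' A by (cases "i = b"; cases "i \<in> A") (auto simp: multi_indices_def)
    qed
    have "\<forall>i\<in>N - {b}. \<beta> i = 0" using 0 \<beta> by (simp add: multi_indices_def) blast
    then have "(\<forall>i\<in>N - {b}. \<beta>' i = 0) \<longleftrightarrow> \<beta>' = \<beta>" if "\<beta>' \<in> multi_indices A (Suc r)" for \<beta>'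
      using unique[OF that] by (intro iffI) simp_all
    moreover have "b \<in> N" using b A(1) by blast
    ultimately have "bpoly A (Suc r) c (x b)
      = (\<Sum>\<beta>'\<in>multi_indices A (Suc r). if \<beta>' = \<beta> then c \<beta> else 0)"
      unfolding bpoly_def by (intro sum.cong refl) (simp add: bmono_vertex)
    then show "c \<beta> = 0"
      using Suc.prems(1)[OF vertex_in_face[OF b]] \<beta> by (simp add: finite_multi_indices fin)
  next
    fix \<beta> a assume \<beta>: "\<beta> \<in> multi_indices A (Suc r)" and a: "a \<in> A - {b}" "\<beta> a > 0"
    let ?\<gamma> = "\<beta>(a := \<beta> a - 1)"
    have \<gamma>: "?\<gamma> \<in> multi_indices A r" using multi_indices_decr[OF fin _ \<beta>] a by blast
    have "?\<gamma>(b := Suc (?\<gamma> b)) \<in> multi_indices A (Suc r)" by (rule multi_indices_incr[OF fin b \<gamma>])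
    moreover have "?\<gamma>(a := Suc (?\<gamma> a)) = \<beta>" using a by auto
    ultimately show "\<beta>(a := \<beta> a - 1, b := Suc (\<beta> b)) \<in> multi_indices A (Suc r) \<and>
      (c (\<beta>(a := \<beta> a - 1, b := Suc (\<beta> b))) = 0 \<longrightarrow> c \<beta> = 0)"
      using transfer[of a ?\<gamma>] \<gamma> a by auto
  qed (use fin in auto)
qed

lemma bpoly_unique:
  assumes "A \<subseteq> N" "A \<noteq> {}" "\<And>y. y \<in> face A \<Longrightarrow> bpoly A r c y = bpoly A r d y"
    and "\<beta> \<in> multi_indices A r"
  shows "c \<beta> = d \<beta>"
proof -
  have "bpoly A r (\<lambda>\<beta>. c \<beta> + (- 1) * d \<beta>) y = 0" if "y \<in> face A" for y
    using assms(3)[OF that] by (simp only: bpoly_add bpoly_cmult)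
  from bpoly_eq_0_imp[OF assms(1,2) this assms(4)] show ?thesis by simp
qed

lemma multi_indices_mono: "A \<subseteq> N \<Longrightarrow> multi_indices A r \<subseteq> multi_indices N r"
proof
  fix \<beta> assume A: "A \<subseteq> N" and \<beta>: "\<beta> \<in> multi_indices A r"
  have "sum \<beta> A = sum \<beta> N" using A \<beta> by (intro sum.mono_neutral_left) (auto simp: multi_indices_def)
  then show "\<beta> \<in> multi_indices N r" using A \<beta> by (auto simp: multi_indices_def)
qed

lemma multi_indices_subset_iff:
  assumes "A \<subseteq> N" "\<beta> \<in> multi_indices N r"
  shows "\<beta> \<in> multi_indices A r \<longleftrightarrow> sum \<beta> (N - A) = 0"
proof -
  have "sum \<beta> N = sum \<beta> A + sum \<beta> (N - A)"
    using assms by (metis finite_N sum.subset_diff add.commute)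
  then show ?thesis
    using assms by (auto simp: multi_indices_def)
qed

lemma bpoly_restrict_coeffs:
  assumes A: "A \<subseteq> N" and 0: "\<And>\<beta>. \<beta> \<in> multi_indices N r - multi_indices A r \<Longrightarrow> c \<beta> * bmono \<beta> y = 0"
  shows "bpoly N r c y = bpoly A r c y"
  unfolding bpoly_def using 0 multi_indices_mono[OF A]
  by (intro sum.mono_neutral_right) (auto simp: finite_multi_indices)

text \<open>A monomial with a positive exponent outside \<open>A\<close> has a factor that is zero
  on the face.\<close>

lemma bpoly_on_face:
  assumes A: "A \<subseteq> N" and y: "y \<in> face A"
  shows "bpoly N r c y = bpoly A r c y"
proof (rule bpoly_restrict_coeffs[OF A])
  fix \<beta> assume \<beta>: "\<beta> \<in> multi_indices N r - multi_indices A r"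
  then have "sum \<beta> (N - A) \<noteq> 0" using multi_indices_subset_iff[OF A] by auto
  then obtain i where i: "i \<in> N - A" "\<beta> i > 0" by auto
  then have "lam i y ^ \<beta> i = 0" using lam_face_zero[OF A i(1) y] by simp
  then have "bmono \<beta> y = 0" unfolding bmono_def using i by (metis Diff_iff finite_N prod_zero)
  then show "c \<beta> * bmono \<beta> y = 0" by simp
qed

lemma linear_dcoef: "A \<subseteq> N \<Longrightarrow> linear (\<lambda>v. dcoef A v c \<gamma>)"
proof -
  assume A: "A \<subseteq> N"
  then have L: "\<And>i. i \<in> A \<Longrightarrow> linear (dlam i)" using linear_dlam by blast
  show ?thesis
    unfolding dcoef_def
    by (rule linearI)
      (simp_all add: linear_add[OF L] linear_scale[OF L] sum.distrib sum_distrib_left algebra_simps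
        cong: sum.cong)
qed

section \<open>Order of vanishing on the opposite face\<close>

lemma vanishes_Suc:
  fixes S :: "(real ^ 'n) set"
  shows "vanishes_to_order_at S (Suc m) u y \<longleftrightarrow>
    u y = 0 \<and> (\<forall>i. vanishes_to_order_at S m (dir_deriv S (axis i 1) u) y)"
proof (intro iffI conjI allI)
  assume v: "vanishes_to_order_at S (Suc m) u y"
  show "u y = 0" using v[unfolded vanishes_to_order_at_def, rule_format, of "[]"] by simp
  fix i
  show "vanishes_to_order_at S m (dir_deriv S (axis i 1) u) y"
    unfolding vanishes_to_order_at_def
  proof (intro allI impI)
    \<comment> \<open>\<open>foldr\<close> applies the last direction first, so the innermost
      derivative is split off at the end of the list. An induction can then replace \<open>u\<close>
      by its first derivatives.\<close>
    fix "is" :: "'n list" assume "length is < m"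
    then show "foldr (\<lambda>i. dir_deriv S (axis i 1)) is (dir_deriv S (axis i 1) u) y = 0"
      using v[unfolded vanishes_to_order_at_def, rule_format, of "is @ [i]"] by simp
  qed
next
  assume v: "u y = 0 \<and> (\<forall>i. vanishes_to_order_at S m (dir_deriv S (axis i 1) u) y)"
  show "vanishes_to_order_at S (Suc m) u y"
    unfolding vanishes_to_order_at_def
  proof (intro allI impI)
    fix "is" :: "'n list" assume "length is < Suc m"
    then show "foldr (\<lambda>i. dir_deriv S (axis i 1)) is u y = 0"
      using v by (cases "is" rule: rev_cases) (auto simp: vanishes_to_order_at_def)
  qed
qed

text \<open>Induction on \<open>m\<close>. Differentiation lowers the total exponent on
  \<open>I\<close> by at most one, which gives one direction. For the other, the derivative along an
  edge from a vertex outside \<open>I\<close> to one in \<open>I\<close> moves an exponent out of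
  \<open>I\<close>, until the multi-index is supported on the opposite face; there the coefficient
  vanishes because \<open>u\<close> does.\<close>

lemma vanishes_iff:
  assumes I: "I \<subseteq> N" "I \<noteq> N" and "m \<le> r"
    and "\<And>z. z \<in> face N \<Longrightarrow> u z = bpoly N r c z"
  shows "(\<forall>y\<in>face (N - I). vanishes_to_order_at (face N) m u y) \<longleftrightarrow>
    (\<forall>\<beta>\<in>multi_indices N r. sum \<beta> I < m \<longrightarrow> c \<beta> = 0)"
  using assms(3,4)
proof (induction m arbitrary: r u c)
  case 0
  then show ?case by (simp add: vanishes_to_order_at_def)
next
  case (Suc m)
  let ?J = "N - I"
  obtain s where r: "r = Suc s" and ms: "m \<le> s" using Suc.prems(1) by (cases r) auto
  have J: "?J \<subseteq> N" "?J \<noteq> {}" using I by auto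
  have u: "\<And>z. z \<in> face N \<Longrightarrow> u z = bpoly N (Suc s) c z" using Suc.prems(2) r by simp
  have finI: "finite I" using I by (simp add: finite_face_indices)
  have du: "dir_deriv (face N) v u z = bpoly N s (dcoef N v c) z" if "z \<in> face N" for z v
    by (rule dir_deriv_bpoly[OF _ that _ u]) (auto simp: tangent_face_N)
  have "(\<forall>y\<in>face ?J. vanishes_to_order_at (face N) (Suc m) u y) \<longleftrightarrow>
    (\<forall>y\<in>face ?J. u y = 0) \<and>
    (\<forall>i. \<forall>y\<in>face ?J. vanishes_to_order_at (face N) m (dir_deriv (face N) (axis i 1) u) y)"
    unfolding vanishes_Suc by blast
  also have "\<dots> \<longleftrightarrow> (\<forall>y\<in>face ?J. u y = 0) \<and>
    (\<forall>i. \<forall>\<gamma>\<in>multi_indices N s. sum \<gamma> I < m \<longrightarrow> dcoef N (axis i 1) c \<gamma> = 0)"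
    using Suc.IH[OF ms du] by simp
  also have "\<dots> \<longleftrightarrow> (\<forall>\<beta>\<in>multi_indices ?J r. c \<beta> = 0) \<and>
    (\<forall>v. \<forall>\<gamma>\<in>multi_indices N s. sum \<gamma> I < m \<longrightarrow> dcoef N v c \<gamma> = 0)"
  proof (rule arg_cong2[where f = conj])
    have uJ: "u y = bpoly ?J r c y" if "y \<in> face ?J" for y
      using that face_mono[OF J(1)] u[of y] bpoly_on_face[OF J(1) that] r by auto
    show "(\<forall>y\<in>face ?J. u y = 0) = (\<forall>\<beta>\<in>multi_indices ?J r. c \<beta> = 0)"
    proof
      assume "\<forall>y\<in>face ?J. u y = 0"
      then show "\<forall>\<beta>\<in>multi_indices ?J r. c \<beta> = 0"
        using bpoly_eq_0_imp[OF J, of r c] uJ by auto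
    next
      assume "\<forall>\<beta>\<in>multi_indices ?J r. c \<beta> = 0"
      then show "\<forall>y\<in>face ?J. u y = 0" using uJ by (auto simp: bpoly_def)
    qed
    \<comment> \<open>Vanishing is defined by coordinate directions, the exchange relations need
      edges; linearity in the direction connects the two.\<close>
    have "dcoef N v c \<gamma> = 0" if "\<And>i. dcoef N (axis i 1) c \<gamma> = 0" for v \<gamma>
    proof -
      have "v = (\<Sum>i\<in>UNIV. (v $ i) *\<^sub>R axis i 1)"
        using basis_expansion[of v] by (simp add: scalar_mult_eq_scaleR)
      then have "dcoef N v c \<gamma> = (\<Sum>i\<in>UNIV. (v $ i) * dcoef N (axis i 1) c \<gamma>)"
        using linear_sum[OF linear_dcoef[of N c \<gamma>]] linear_scale[OF linear_dcoef[of N c \<gamma>]]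
        by (smt (verit) order_refl real_scaleR_def sum.cong)
      then show ?thesis using that by simp
    qed
    then show "(\<forall>i. \<forall>\<gamma>\<in>multi_indices N s. sum \<gamma> I < m \<longrightarrow> dcoef N (axis i 1) c \<gamma> = 0) =
      (\<forall>v. \<forall>\<gamma>\<in>multi_indices N s. sum \<gamma> I < m \<longrightarrow> dcoef N v c \<gamma> = 0)"
      by blast
  qed
  also have "\<dots> \<longleftrightarrow> (\<forall>\<beta>\<in>multi_indices N r. sum \<beta> I < Suc m \<longrightarrow> c \<beta> = 0)"
  proof (intro iffI conjI allI ballI impI; (elim conjE)?)
    fix \<beta>
    assume base: "\<forall>\<beta>\<in>multi_indices ?J r. c \<beta> = 0"
      and deriv: "\<forall>v. \<forall>\<gamma>\<in>multi_indices N s. sum \<gamma> I < m \<longrightarrow> dcoef N v c \<gamma> = 0"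
      and \<beta>: "\<beta> \<in> multi_indices N r" "sum \<beta> I < Suc m"
    obtain b where b: "b \<in> N" "b \<notin> I" using J by auto
    show "c \<beta> = 0"
    proof (rule vanishing_by_transfer[of I b "{\<beta>\<in>multi_indices N r. sum \<beta> I < Suc m}" c])
      fix \<beta> assume \<beta>: "\<beta> \<in> {\<beta> \<in> multi_indices N r. sum \<beta> I < Suc m}" "\<forall>i\<in>I. \<beta> i = 0"
      have "N - ?J = I" using I by auto
      then have "\<beta> \<in> multi_indices ?J r" using multi_indices_subset_iff[OF J(1), of \<beta> r] \<beta> by simp
      then show "c \<beta> = 0" using base by blast
    next
      fix \<beta> a assume \<beta>: "\<beta> \<in> {\<beta> \<in> multi_indices N r. sum \<beta> I < Suc m}" and a: "a \<in> I" "\<beta> a > 0"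
      let ?\<gamma> = "\<beta>(a := \<beta> a - 1)"
      have aN: "a \<in> N" and ab: "a \<noteq> b" using a b I by auto
      have \<gamma>: "?\<gamma> \<in> multi_indices N s"
        using multi_indices_decr[OF finite_N aN] \<beta> a r by simp
      have b\<gamma>: "?\<gamma>(b := Suc (?\<gamma> b)) \<in> multi_indices N r"
        unfolding r by (rule multi_indices_incr[OF finite_N b(1) \<gamma>])
      have a\<gamma>: "?\<gamma>(a := Suc (?\<gamma> a)) = \<beta>" using a by auto
      have sum: "sum \<beta> I = Suc (sum ?\<gamma> I)"
        using sum_incr[OF finI, of ?\<gamma> a] a unfolding a\<gamma> by simp
      have "sum (?\<gamma>(b := Suc (?\<gamma> b))) I < Suc m"
        unfolding sum_incr[OF finI] using sum \<beta> b by simp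
      moreover have "real (Suc (?\<gamma> a)) * c \<beta> = real (Suc (?\<gamma> b)) * c (?\<gamma>(b := Suc (?\<gamma> b)))"
        using deriv[rule_format, OF \<gamma>, of "x a - x b"] \<beta> sum aN b
        unfolding dcoef_edge[OF order_refl aN b(1)] a\<gamma> by simp
      ultimately show "\<beta>(a := \<beta> a - 1, b := Suc (\<beta> b)) \<in> {\<beta> \<in> multi_indices N r. sum \<beta> I < Suc m} \<and>
        (c (\<beta>(a := \<beta> a - 1, b := Suc (\<beta> b))) = 0 \<longrightarrow> c \<beta> = 0)"
        using b\<gamma> ab by auto
    qed (use \<beta> b finI in auto)
  next
    fix \<beta> assume c: "\<forall>\<beta>\<in>multi_indices N r. sum \<beta> I < Suc m \<longrightarrow> c \<beta> = 0" and \<beta>: "\<beta> \<in> multi_indices ?J r"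
    have "N - ?J = I" using I by auto
    then show "c \<beta> = 0"
      using c \<beta> multi_indices_mono[OF J(1), of r] multi_indices_subset_iff[OF J(1), of \<beta> r]
      by fastforce
  next
    fix v \<gamma> assume c: "\<forall>\<beta>\<in>multi_indices N r. sum \<beta> I < Suc m \<longrightarrow> c \<beta> = 0"
      and \<gamma>: "\<gamma> \<in> multi_indices N s" "sum \<gamma> I < m"
    have "c (\<gamma>(i := Suc (\<gamma> i))) = 0" if "i \<in> N" for i
      using c multi_indices_incr[OF finite_N that \<gamma>(1)] \<gamma>(2) unfolding r
      by (simp add: sum_incr[OF finI] del: fun_upd_apply)
    then show "dcoef N v c \<gamma> = 0" by (simp add: dcoef_def)
  qed
  finally show ?case .
qed

section \<open>Equivalence of Bernstein form and Cartesian form\<close>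

definition representable :: "nat set \<Rightarrow> nat \<Rightarrow> (real ^ 'n \<Rightarrow> real) \<Rightarrow> bool" where
  "representable A r p \<longleftrightarrow> (\<exists>c. \<forall>y\<in>face A. p y = bpoly A r c y)"

lemma representable_cong:
  "representable A r p \<Longrightarrow> (\<And>y. y \<in> face A \<Longrightarrow> p y = q y) \<Longrightarrow> representable A r q"
  by (auto simp: representable_def)

lemma representable_add:
  assumes "representable A r p" "representable A r q"
  shows "representable A r (\<lambda>y. p y + q y)"
proof -
  obtain c d where "\<forall>y\<in>face A. p y = bpoly A r c y" "\<forall>y\<in>face A. q y = bpoly A r d y"
    using assms by (auto simp: representable_def)
  then show ?thesis
    unfolding representable_def by (intro exI[of _ "\<lambda>\<beta>. c \<beta> + d \<beta>"]) (simp add: bpoly_add)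
qed

lemma representable_cmult:
  assumes "representable A r p"
  shows "representable A r (\<lambda>y. a * p y)"
proof -
  obtain c where "\<forall>y\<in>face A. p y = bpoly A r c y"
    using assms by (auto simp: representable_def)
  then show ?thesis
    unfolding representable_def by (intro exI[of _ "\<lambda>\<beta>. a * c \<beta>"]) (simp add: bpoly_cmult)
qed

lemma representable_0: "representable A r (\<lambda>y. 0)"
  unfolding representable_def by (intro exI[of _ "\<lambda>\<beta>. 0"]) (simp add: bpoly_0)

lemma representable_sum:
  "(\<And>i. i \<in> B \<Longrightarrow> representable A r (p i)) \<Longrightarrow> representable A r (\<lambda>y. \<Sum>i\<in>B. p i y)"
  by (induction B rule: infinite_finite_induct) (auto intro: representable_0 representable_add)

lemma representable_lam_mult:
  assumes A: "A \<subseteq> N" and i: "i \<in> A" and p: "representable A r p"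
  shows "representable A (Suc r) (\<lambda>y. lam i y * p y)"
proof -
  obtain c where c: "\<forall>y\<in>face A. p y = bpoly A r c y"
    using p by (auto simp: representable_def)
  define d where "d \<beta> = (if \<beta> i > 0 then c (\<beta>(i := \<beta> i - 1)) else 0)" for \<beta>
  have fin: "finite A" and iN: "i \<in> N" using A i by (auto simp: finite_face_indices)
  have "bpoly A (Suc r) d y = lam i y * bpoly A r c y" for y
  proof -
    have "bpoly A (Suc r) d y = (\<Sum>\<beta> | \<beta> \<in> multi_indices A (Suc r) \<and> \<beta> i > 0. d \<beta> * bmono \<beta> y)"
      unfolding bpoly_def
      by (intro sum.mono_neutral_right) (auto simp: finite_multi_indices fin d_def)
    also have "\<dots> = lam i y * bpoly A r c y"
      unfolding sum_multi_indices_incr[OF fin i] bmono_incr[OF iN] bpoly_def sum_distrib_left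
      by (intro sum.cong) (auto simp: d_def)
    finally show ?thesis .
  qed
  then show ?thesis unfolding representable_def using c by (intro exI[of _ d]) simp
qed

text \<open>Degree elevation: multiply by the sum of the \<open>lam i\<close> over \<open>A\<close>,
  which equals 1 on the face. This makes the form homogeneous of degree exactly
  \<open>r\<close>.\<close>

lemma representable_Suc:
  assumes A: "A \<subseteq> N" and p: "representable A r p"
  shows "representable A (Suc r) p"
proof (rule representable_cong)
  show "representable A (Suc r) (\<lambda>y. \<Sum>i\<in>A. lam i y * p y)"
    by (intro representable_sum representable_lam_mult[OF A _ p])
  show "(\<Sum>i\<in>A. lam i y * p y) = p y" if "y \<in> face A" for y
    using sum_lam_face[OF A that] by (simp flip: sum_distrib_right)
qed

text \<open>On the face a Cartesian coordinate is the combination of the \<open>lam i\<close>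
  weighted by the coordinates of the vertices.\<close>

lemma representable_coord_mult:
  assumes A: "A \<subseteq> N" and p: "representable A r p"
  shows "representable A (Suc r) (\<lambda>y. y $ j * p y)"
proof (rule representable_cong)
  show "representable A (Suc r) (\<lambda>y. \<Sum>i\<in>A. x i $ j * (lam i y * p y))"
    by (intro representable_sum representable_cmult representable_lam_mult[OF A _ p])
  show "(\<Sum>i\<in>A. x i $ j * (lam i y * p y)) = y $ j * p y" if "y \<in> face A" for y
  proof -
    have "y $ j = (\<Sum>i\<in>A. lam i y *\<^sub>R x i) $ j" using sum_lam_face(2)[OF A that] by simp
    then show ?thesis by (simp add: sum_distrib_right sum_distrib_left mult_ac)
  qed
qed

lemma representable_monomial:
  assumes A: "A \<subseteq> N"
  shows "representable A (sum m F) (\<lambda>y. \<Prod>i\<in>F. (y $ i) ^ m i)"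
proof (induction F rule: infinite_finite_induct)
  case (insert j F)
  have "representable A (k + sum m F) (\<lambda>y. (y $ j) ^ k * (\<Prod>i\<in>F. (y $ i) ^ m i))" for k
  proof (induction k)
    case 0
    show ?case using insert.IH by simp
  next
    case (Suc k)
    show ?case using representable_coord_mult[OF A Suc, of j] by (simp add: mult.assoc)
  qed
  from this[of "m j"] show ?case using insert.hyps by simp
qed (auto simp: representable_def bpoly_degree_0 A intro!: exI[of _ "\<lambda>_. 1"])

lemma representable_poly_fun:
  assumes A: "A \<subseteq> N" and p: "poly_fun r p"
  shows "representable A r p"
proof -
  obtain c where c: "\<And>y. p y = (\<Sum>m \<in> {m. sum m UNIV \<le> r}. c m * (\<Prod>i\<in>UNIV. (y $ i) ^ m i))"
    using p unfolding poly_fun_def by blast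
  have raised: "representable A (d + sum m UNIV) (\<lambda>y. \<Prod>i\<in>UNIV. (y $ i) ^ m i)" for d m
    by (induction d) (simp_all add: representable_monomial[OF A] representable_Suc[OF A])
  have "representable A r (\<lambda>y. \<Prod>i\<in>UNIV. (y $ i) ^ m i)" if "sum m UNIV \<le> r" for m
    using raised[of "r - sum m UNIV" m] that by simp
  then have "representable A r (\<lambda>y. \<Sum>m \<in> {m. sum m UNIV \<le> r}. c m * (\<Prod>i\<in>UNIV. (y $ i) ^ m i))"
    by (intro representable_sum representable_cmult) simp
  then show ?thesis unfolding c[abs_def] .
qed

lemma poly_fun_lam_mult:
  assumes i: "i \<in> N" and p: "poly_fun r p"
  shows "poly_fun (Suc r) (\<lambda>y. lam i y * p y)"
proof -
  have "lam i y * p y = lam i 0 * p y + (\<Sum>j\<in>UNIV. dlam i (axis j 1) * (y $ j * p y))" for y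
  proof -
    have "y = (\<Sum>j\<in>UNIV. (y $ j) *\<^sub>R axis j 1)"
      using basis_expansion[of y] by (simp add: scalar_mult_eq_scaleR)
    then have "dlam i y = (\<Sum>j\<in>UNIV. (y $ j) * dlam i (axis j 1))"
      using linear_sum[OF linear_dlam[OF i]] linear_scale[OF linear_dlam[OF i]]
      by (smt (verit) real_scaleR_def sum.cong)
    then show ?thesis
      using lam_add[OF i, of 0 y] by (simp add: distrib_left sum_distrib_left mult_ac)
  qed
  then show ?thesis
    using p by (auto intro!: poly_fun_add poly_fun_sum poly_fun_cmult poly_fun_coord_mult
        intro: poly_fun_Suc)
qed

lemma poly_fun_bmono:
  assumes "\<beta> \<in> multi_indices N r"
  shows "poly_fun r (bmono \<beta>)"
  using assms
proof (induction r arbitrary: \<beta>)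
  case 0
  then show ?case using poly_fun_1 by (simp add: multi_indices_0 bmono_def[abs_def])
next
  case (Suc r)
  then have "sum \<beta> N \<noteq> 0" by (simp add: multi_indices_def)
  then obtain i where i: "i \<in> N" "\<beta> i > 0" by auto
  let ?\<gamma> = "\<beta>(i := \<beta> i - 1)"
  have "\<beta> = ?\<gamma>(i := Suc (?\<gamma> i))" using i by auto
  then have "bmono \<beta> = (\<lambda>y. lam i y * bmono ?\<gamma> y)" using bmono_incr[OF i(1)] by metis
  then show ?case
    using poly_fun_lam_mult[OF i(1) Suc.IH[OF multi_indices_decr[OF finite_N i(1) Suc.prems i(2)]]]
    by (simp only:)
qed

lemma poly_fun_bpoly:
  assumes "A \<subseteq> N"
  shows "poly_fun r (bpoly A r c)"
  unfolding bpoly_def[abs_def]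
  using multi_indices_mono[OF assms] by (intro poly_fun_sum poly_fun_cmult poly_fun_bmono) auto

end


section \<open>Alternating forms with Bernstein coefficients\<close>

lemma form_args_length: "vs \<in> form_args k S \<Longrightarrow> length vs = k"
  by (simp add: form_args_def)

lemma form_args_nth: "vs \<in> form_args k S \<Longrightarrow> i < k \<Longrightarrow> vs ! i \<in> tangent S"
  by (auto simp: form_args_def)

lemma form_args_update: "vs \<in> form_args k S \<Longrightarrow> u \<in> tangent S \<Longrightarrow> vs[i := u] \<in> form_args k S"
  using set_update_subset_insert[of vs i u] by (auto simp: form_args_def)

lemma form_args_map:
  "vs \<in> form_args k S \<Longrightarrow> (\<And>v. v \<in> tangent S \<Longrightarrow> h v \<in> tangent S') \<Longrightarrow> map h vs \<in> form_args k S'"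
  by (auto simp: form_args_def)

lemma multilinear_update:
  assumes "multilinear_alternating k S a" "vs \<in> form_args k S" "i < k" "u \<in> tangent S" "w \<in> tangent S"
  shows "a (vs[i := c *\<^sub>R u + d *\<^sub>R w]) = c * a (vs[i := u]) + d * a (vs[i := w])"
  using assms by (simp add: multilinear_alternating_def)

lemma alternating_eq_0:
  assumes "multilinear_alternating k S a" "vs \<in> form_args k S" "i < k" "j < k" "i \<noteq> j" "vs ! i = vs ! j"
  shows "a vs = 0"
  using assms unfolding multilinear_alternating_def by blast

lemma multilinear_add:
  assumes "multilinear_alternating k S a" "vs \<in> form_args k S" "i < k" "u \<in> tangent S" "w \<in> tangent S"
  shows "a (vs[i := u + w]) = a (vs[i := u]) + a (vs[i := w])"
  using multilinear_update[OF assms, of 1 1] by simp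

lemma multilinear_0:
  assumes "multilinear_alternating k S a" "vs \<in> form_args k S" "i < k"
  shows "a (vs[i := 0]) = 0"
  using multilinear_update[OF assms tangent_zero tangent_zero, of 0 0] by simp

lemma multilinear_alternatingI:
  assumes "\<And>vs i u w c d. vs \<in> form_args k S \<Longrightarrow> i < k \<Longrightarrow> u \<in> tangent S \<Longrightarrow> w \<in> tangent S \<Longrightarrow>
      a (vs[i := c *\<^sub>R u + d *\<^sub>R w]) = c * a (vs[i := u]) + d * a (vs[i := w])"
    and "\<And>vs i j. vs \<in> form_args k S \<Longrightarrow> i < k \<Longrightarrow> j < k \<Longrightarrow> i \<noteq> j \<Longrightarrow> vs ! i = vs ! j \<Longrightarrow> a vs = 0"
  shows "multilinear_alternating k S a"
  unfolding multilinear_alternating_def using assms by blast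

lemma multilinear_alternating_cong:
  assumes "multilinear_alternating k S a" "\<And>vs. vs \<in> form_args k S \<Longrightarrow> a vs = b vs"
  shows "multilinear_alternating k S b"
proof (rule multilinear_alternatingI)
  fix vs i u w and c d :: real
  assume *: "vs \<in> form_args k S" "i < k" "u \<in> tangent S" "w \<in> tangent S"
  have "c *\<^sub>R u + d *\<^sub>R w \<in> tangent S" using * by (intro tangent_add tangent_scale)
  then show "b (vs[i := c *\<^sub>R u + d *\<^sub>R w]) = c * b (vs[i := u]) + d * b (vs[i := w])"
    using multilinear_update[OF assms(1) *, of c d] * by (simp add: assms(2)[symmetric] form_args_update)
next
  fix vs i j assume "vs \<in> form_args k S" "i < k" "j < k" "i \<noteq> j" "vs ! i = vs ! j"
  then show "b vs = 0" using alternating_eq_0[OF assms(1)] assms(2) by simp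
qed

lemma multilinear_alternating_lincomb:
  assumes "multilinear_alternating k S a" "multilinear_alternating k S b"
  shows "multilinear_alternating k S (\<lambda>vs. s * a vs + t * b vs)"
proof (rule multilinear_alternatingI)
  fix vs i u w and c d :: real
  assume *: "vs \<in> form_args k S" "i < k" "u \<in> tangent S" "w \<in> tangent S"
  show "s * a (vs[i := c *\<^sub>R u + d *\<^sub>R w]) + t * b (vs[i := c *\<^sub>R u + d *\<^sub>R w]) =
    c * (s * a (vs[i := u]) + t * b (vs[i := u])) + d * (s * a (vs[i := w]) + t * b (vs[i := w]))"
    unfolding multilinear_update[OF assms(1) *] multilinear_update[OF assms(2) *]
    by (simp add: algebra_simps)
qed (simp add: alternating_eq_0[OF assms(1)] alternating_eq_0[OF assms(2)])

lemma multilinear_alternating_zero: "multilinear_alternating k S (\<lambda>vs. 0)"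
  by (rule multilinear_alternatingI) simp_all

lemma multilinear_alternating_sum:
  assumes "\<And>j. j \<in> B \<Longrightarrow> multilinear_alternating k S (a j)"
  shows "multilinear_alternating k S (\<lambda>vs. \<Sum>j\<in>B. s j * a j vs)"
  using assms
proof (induction B rule: infinite_finite_induct)
  case (insert j B)
  then show ?case
    using multilinear_alternating_lincomb[of k S "a j" "\<lambda>vs. \<Sum>j\<in>B. s j * a j vs" "s j" 1] by simp
qed (simp_all add: multilinear_alternating_zero)

lemma multilinear_alternating_map:
  assumes a: "multilinear_alternating k S a" and h: "linear h"
    and img: "\<And>v. v \<in> tangent S' \<Longrightarrow> h v \<in> tangent S"
  shows "multilinear_alternating k S' (\<lambda>vs. a (map h vs))"
proof (rule multilinear_alternatingI)
  fix vs i u w and c d :: real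
  assume *: "vs \<in> form_args k S'" "i < k" "u \<in> tangent S'" "w \<in> tangent S'"
  show "a (map h (vs[i := c *\<^sub>R u + d *\<^sub>R w])) = c * a (map h (vs[i := u])) + d * a (map h (vs[i := w]))"
    using multilinear_update[OF a form_args_map[OF *(1) img] *(2) img[OF *(3)] img[OF *(4)]]
    by (simp add: map_update linear_add[OF h] linear_scale[OF h])
next
  fix vs i j assume *: "vs \<in> form_args k S'" "i < k" "j < k" "i \<noteq> j" "vs ! i = vs ! j"
  show "a (map h vs) = 0"
    by (rule alternating_eq_0[OF a form_args_map[OF *(1) img] *(2,3,4)])
      (use * in \<open>simp_all add: form_args_length\<close>)
qed

text \<open>Polarization: the map vanishes when both slots hold the sum of the two vectors;
  expanding leaves the two mixed terms.\<close>

lemma alternating_swap: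
  assumes a: "multilinear_alternating k S a" and vs: "vs \<in> form_args k S" and ij: "i < k" "j < k" "i \<noteq> j"
  shows "a (vs[i := vs ! j, j := vs ! i]) = - a vs"
proof -
  define B where "B u w = a (vs[i := u, j := w])" for u w
  have len: "length vs = k" using vs by (rule form_args_length)
  have T: "vs ! i \<in> tangent S" "vs ! j \<in> tangent S" using vs ij by (simp_all add: form_args_nth)
  have diag: "B u u = 0" if "u \<in> tangent S" for u
    unfolding B_def
    using that vs ij len by (intro alternating_eq_0[OF a _ ij]) (simp_all add: form_args_update)
  have B2: "B u (w + z) = B u w + B u z" if "u \<in> tangent S" "w \<in> tangent S" "z \<in> tangent S" for u w z
    unfolding B_def using that vs ij by (intro multilinear_add[OF a]) (simp_all add: form_args_update)
  have B1: "B (w + z) u = B w u + B z u" if "u \<in> tangent S" "w \<in> tangent S" "z \<in> tangent S" for u w z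
    unfolding B_def list_update_swap[OF ij(3)]
    using that vs ij by (intro multilinear_add[OF a]) (simp_all add: form_args_update)
  let ?u = "vs ! i" and ?w = "vs ! j"
  have "0 = B (?u + ?w) (?u + ?w)" using diag T by (simp add: tangent_add)
  also have "\<dots> = B ?u (?u + ?w) + B ?w (?u + ?w)" by (rule B1) (use T in \<open>simp_all add: tangent_add\<close>)
  also have "\<dots> = (B ?u ?u + B ?u ?w) + (B ?w ?u + B ?w ?w)" by (simp only: B2 T)
  finally have "B ?w ?u = - B ?u ?w" by (simp add: diag T)
  moreover have "vs[i := ?u, j := ?w] = vs" by simp
  ultimately show ?thesis by (simp add: B_def)
qed

text \<open>The slots are replaced one at a time from the left;
  \<open>map h (take m vs) @ drop m vs\<close> is the list after \<open>m\<close>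
  replacements.\<close>

lemma multilinear_map_eq:
  assumes h: "\<And>v. v \<in> tangent S \<Longrightarrow> h v \<in> tangent S"
    and eq: "\<And>vs i. vs \<in> form_args k S \<Longrightarrow> i < k \<Longrightarrow> a (vs[i := h (vs ! i)]) = a vs"
    and vs: "vs \<in> form_args k S"
  shows "a (map h vs) = a vs"
proof -
  have "a (map h (take m vs) @ drop m vs) = a vs" if "m \<le> k" for m
    using that
  proof (induction m)
    case (Suc m)
    let ?ws = "map h (take m vs) @ drop m vs"
    have len: "length vs = k" using vs by (rule form_args_length)
    have "?ws \<in> form_args k S"
      using vs h len Suc.prems by (auto simp: form_args_def dest: in_set_takeD in_set_dropD)
    moreover have "?ws ! m = vs ! m" using len Suc.prems by (simp add: nth_append)
    moreover have "map h (take (Suc m) vs) @ drop (Suc m) vs = ?ws[m := h (vs ! m)]"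
      using len Suc.prems
      by (intro nth_equalityI) (auto simp: nth_append nth_list_update less_Suc_eq min_def)
    ultimately show ?case using eq[of ?ws m] Suc by simp
  qed simp
  from this[of k] show ?thesis using form_args_length[OF vs] by simp
qed

text \<open>Slots are freed one at a time: \<open>m\<close> counts the leading slots that may hold
  arbitrary tangent vectors, the later ones being still confined to \<open>B\<close>.\<close>

lemma multilinear_eq_0_on_spanning_set:
  assumes a: "multilinear_alternating k S a"
    and B: "B \<subseteq> tangent S" "tangent S \<subseteq> span B"
    and 0: "\<And>vs. length vs = k \<Longrightarrow> set vs \<subseteq> B \<Longrightarrow> a vs = 0"
    and vs: "vs \<in> form_args k S"
  shows "a vs = 0"
proof -
  have "\<forall>vs\<in>form_args k S. (\<forall>i. m \<le> i \<and> i < k \<longrightarrow> vs ! i \<in> B) \<longrightarrow> a vs = 0" if "m \<le> k" for m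
    using that
  proof (induction m)
    case 0
    show ?case
      using assms(4) by (auto simp: form_args_def subset_iff in_set_conv_nth)
  next
    case (Suc m)
    show ?case
    proof (intro ballI impI)
      fix vs assume vs: "vs \<in> form_args k S" and Bs: "\<forall>i. Suc m \<le> i \<and> i < k \<longrightarrow> vs ! i \<in> B"
      have m: "m < k" using Suc.prems by simp
      have len: "length vs = k" using vs by (rule form_args_length)
      have "vs ! m \<in> span B" using form_args_nth[OF vs m] B(2) by blast
      \<comment> \<open>Tangency is carried through the span induction because multilinearity is
        available for tangent vectors only.\<close>
      then have "vs ! m \<in> tangent S \<and> a (vs[m := vs ! m]) = 0"
      proof (induction rule: span_induct_alt)
        case base
        show ?case using multilinear_0[OF a vs m] by (simp add: tangent_zero)
      next
        case (step c u w)
        have u: "u \<in> tangent S" using step B(1) by blast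
        have "a (vs[m := u]) = 0"
        proof (rule Suc.IH[rule_format])
          show "vs[m := u] \<in> form_args k S" using vs u by (rule form_args_update)
          show "vs[m := u] ! i \<in> B" if "m \<le> i \<and> i < k" for i
            using that Bs step(1) len by (cases "i = m") auto
        qed (use m in simp)
        then show ?case
          using multilinear_update[OF a vs m u, of w c 1] step u by (simp add: tangent_add tangent_scale)
      qed
      then show "a vs = 0" by simp
    qed
  qed
  from this[of k] vs show ?thesis by auto
qed

text \<open>A repeated index gives 0. A list of distinct indices arises from its sorted version by
  transpositions, each of which only changes the sign.\<close>

lemma alternating_eq_0_if_increasing:
  assumes a: "multilinear_alternating k S a" and e: "\<And>i. i \<in> A \<Longrightarrow> e i \<in> tangent S"
    and 0: "\<And>\<sigma>. \<sigma> \<in> increasing_lists A k \<Longrightarrow> a (map e \<sigma>) = 0"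
    and \<tau>: "length \<tau> = k" "set \<tau> \<subseteq> A"
  shows "a (map e \<tau>) = 0"
proof (cases "distinct \<tau>")
  case False
  then obtain i j where "i < k" "j < k" "i \<noteq> j" "\<tau> ! i = \<tau> ! j"
    using \<tau> by (auto simp: distinct_conv_nth)
  then show ?thesis
    using \<tau> e by (intro alternating_eq_0[OF a, of _ i j]) (auto simp: form_args_def)
next
  case True
  obtain p where p: "p permutes {..<length (sort \<tau>)}" "permute_list p (sort \<tau>) = \<tau>"
    using mset_eq_permutation[of \<tau> "sort \<tau>"] by (metis mset_sort)
  have "sort \<tau> \<in> increasing_lists A k"
    using True \<tau> by (simp add: increasing_lists_def strict_sorted_iff)
  then have base: "a (map e (sort \<tau>)) = 0" by (rule 0)
  have "a (map e (permute_list p (sort \<tau>))) = 0"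
    using finite_lessThan p(1)
  proof (induction p rule: permutes_rev_induct)
    case id
    show ?case using base by simp
  next
    case (swap i j p)
    let ?\<rho> = "permute_list p (sort \<tau>)"
    have len: "length ?\<rho> = k" using \<tau> by simp
    have ij: "i < k" "j < k" using swap \<tau> by auto
    have set: "set ?\<rho> \<subseteq> A" using swap \<tau> by simp
    have "permute_list (p \<circ> Transposition.transpose i j) (sort \<tau>) = permute_list (Transposition.transpose i j) ?\<rho>"
      using swap by (intro permute_list_compose permutes_swap_id) auto
    also have "map e \<dots> = (map e ?\<rho>)[i := map e ?\<rho> ! j, j := map e ?\<rho> ! i]"
      using ij len
      by (intro nth_equalityI)
        (auto simp: permute_list_def nth_list_update Transposition.transpose_def)
    finally have eq: "map e (permute_list (p \<circ> Transposition.transpose i j) (sort \<tau>))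
      = (map e ?\<rho>)[i := map e ?\<rho> ! j, j := map e ?\<rho> ! i]" .
    have "map e ?\<rho> \<in> form_args k S" using len set e by (auto simp: form_args_def)
    then show ?case
      unfolding eq using alternating_swap[OF a _ ij swap(3), of "map e ?\<rho>"] swap.IH by simp
  qed
  then show ?thesis using p by simp
qed

text \<open>Linearity: under each permutation exactly one factor sees slot \<open>i\<close>.
  Alternation: composing with the transposition of two equal slots keeps every product and flips
  every sign, so the sum is its own negative.\<close>

lemma wedge_multilinear_alternating:
  assumes y: "y \<in> S" and len: "length \<theta>s = k"
    and lin: "\<And>\<theta> u w c d. \<theta> \<in> set \<theta>s \<Longrightarrow> u \<in> tangent S \<Longrightarrow> w \<in> tangent S \<Longrightarrow>
      \<theta> y (c *\<^sub>R u + d *\<^sub>R w) = c * \<theta> y u + d * \<theta> y w"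
  shows "multilinear_alternating k S (wedge S \<theta>s y)"
proof (rule multilinear_alternating_cong)
  let ?W = "\<lambda>vs. \<Sum>p | p permutes {..<k}. of_int (sign p) * (\<Prod>l<k. (\<theta>s ! l) y (vs ! p l)) :: real"
  show "?W vs = wedge S \<theta>s y vs" if "vs \<in> form_args k S" for vs
    using y len that by (simp add: wedge_def)
  show "multilinear_alternating k S ?W"
  proof (rule multilinear_alternatingI)
    fix vs i u w and c d :: real
    assume vs: "vs \<in> form_args k S" and i: "i < k" and u: "u \<in> tangent S" and w: "w \<in> tangent S"
    have lvs: "length vs = k" using vs by (rule form_args_length)
    have "of_int (sign p) * (\<Prod>l<k. (\<theta>s ! l) y (vs[i := c *\<^sub>R u + d *\<^sub>R w] ! p l))
      = c * (of_int (sign p) * (\<Prod>l<k. (\<theta>s ! l) y (vs[i := u] ! p l)))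
      + d * (of_int (sign p) * (\<Prod>l<k. (\<theta>s ! l) y (vs[i := w] ! p l)))"
      if p: "p permutes {..<k}" for p
    proof -
      obtain l where l: "l < k" "p l = i"
        using p i by (metis lessThan_iff permutes_inverses(1) permutes_inv permutes_in_image)
      have other: "i \<noteq> p m" if "m \<noteq> l" for m using that l p by (metis permutes_inj injD)
      have prod: "(\<Prod>m<k. (\<theta>s ! m) y (vs[i := z] ! p m))
        = (\<theta>s ! l) y z * (\<Prod>m\<in>{..<k} - {l}. (\<theta>s ! m) y (vs ! p m))" for z
      proof -
        have "(\<Prod>m\<in>{..<k} - {l}. (\<theta>s ! m) y (vs[i := z] ! p m))
          = (\<Prod>m\<in>{..<k} - {l}. (\<theta>s ! m) y (vs ! p m))"
          by (rule prod.cong) (simp_all add: other)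
        then show ?thesis using l lvs i by (simp add: prod.remove[of "{..<k}" l])
      qed
      have "\<theta>s ! l \<in> set \<theta>s" using l len by simp
      then show ?thesis unfolding prod by (simp add: lin u w algebra_simps)
    qed
    then show "?W (vs[i := c *\<^sub>R u + d *\<^sub>R w]) = c * ?W (vs[i := u]) + d * ?W (vs[i := w])"
      by (simp add: sum_distrib_left sum.distrib)
  next
    fix vs i j assume vs: "vs \<in> form_args k S" and ij: "i < k" "j < k" "i \<noteq> j" "vs ! i = vs ! j"
    let ?g = "\<lambda>p. of_int (sign p) * (\<Prod>l<k. (\<theta>s ! l) y (vs ! p l)) :: real"
    have t: "Transposition.transpose i j permutes {..<k}" using ij by (intro permutes_swap_id) auto
    have "?W vs = (\<Sum>p | p permutes {..<k}. ?g (Transposition.transpose i j \<circ> p))"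
      by (rule setum_permutations_compose_left[OF t])
    also have "\<dots> = (\<Sum>p | p permutes {..<k}. - ?g p)"
    proof (rule sum.cong[OF refl])
      fix p assume "p \<in> {p. p permutes {..<k}}"
      then have "permutation p" using permutation_permutes[of p] finite_lessThan[of k] by blast
      then have "sign (Transposition.transpose i j \<circ> p) = - sign p"
        using ij by (simp add: sign_compose permutation_swap_id sign_swap_id)
      moreover have "vs ! ((Transposition.transpose i j \<circ> p) l) = vs ! p l" for l
        using ij by (simp add: Transposition.transpose_def)
      ultimately show "?g (Transposition.transpose i j \<circ> p) = - ?g p" by simp
    qed
    also have "\<dots> = - ?W vs" by (simp add: sum_negf)
    finally show "?W vs = 0" by simp
  qed
qed

lemma finite_increasing_lists: "finite A \<Longrightarrow> finite (increasing_lists A k)"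
  by (rule finite_subset[OF _ finite_lists_length_eq[of A k]]) (auto simp: increasing_lists_def)

section \<open>Wedges of barycentric differentials, and forms with alternating coefficients\<close>

context nondegenerate_simplex
begin

lemma wedge_d_bary:
  assumes "A \<subseteq> N" "set \<sigma> \<subseteq> A" "y \<in> face A" "vs \<in> form_args (length \<sigma>) (face A)"
  shows "wedge (face A) (map (d_bary x (face A)) \<sigma>) y vs =
    (\<Sum>p | p permutes {..<length \<sigma>}. of_int (sign p) * (\<Prod>i<length \<sigma>. dlam (\<sigma> ! i) (vs ! p i)))"
proof -
  have "d_bary x (face A) (\<sigma> ! i) y (vs ! p i) = dlam (\<sigma> ! i) (vs ! p i)"
    if "i < length \<sigma>" "p permutes {..<length \<sigma>}" for i p
  proof (rule d_bary_face[OF assms(1) _ assms(3)])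
    show "\<sigma> ! i \<in> A" using assms that by auto
    show "vs ! p i \<in> tangent (face A)"
      using that permutes_in_image[OF that(2), of i] by (intro form_args_nth[OF assms(4)]) auto
  qed
  then show ?thesis
    using assms by (auto simp: wedge_def intro!: sum.cong prod.cong)
qed

text \<open>For indices other than \<open>b\<close>, the \<open>dlam i\<close> are dual to the edges
  at \<open>x b\<close>. A permutation contributes only if it matches \<sigma> with \<tau> entry by
  entry, and as both lists increase strictly this forces equal lists and the identity
  permutation.\<close>

lemma wedge_dual_basis:
  assumes A: "A \<subseteq> N" and b: "b \<in> A" and y: "y \<in> face A"
    and \<sigma>: "\<sigma> \<in> increasing_lists (A - {b}) k" and \<tau>: "\<tau> \<in> increasing_lists (A - {b}) k"
  shows "wedge (face A) (map (d_bary x (face A)) \<sigma>) y (map (\<lambda>i. x i - x b) \<tau>)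
    = (if \<sigma> = \<tau> then 1 else 0)"
proof -
  have len: "length \<sigma> = k" "length \<tau> = k" and sets: "set \<sigma> \<subseteq> A - {b}" "set \<tau> \<subseteq> A - {b}"
    and sorted: "sorted_wrt (<) \<sigma>" "sorted_wrt (<) \<tau>"
    using \<sigma> \<tau> by (auto simp: increasing_lists_def)
  have arg: "map (\<lambda>i. x i - x b) \<tau> \<in> form_args (length \<sigma>) (face A)"
    using len sets b by (auto simp: form_args_def intro!: edge_in_tangent)
  have summand: "(\<Prod>i<k. dlam (\<sigma> ! i) (map (\<lambda>i. x i - x b) \<tau> ! p i))
    = (if \<sigma> = \<tau> \<and> p = id then 1 else (0 :: real))" if p: "p permutes {..<k}" for p
  proof -
    have pk: "p i < k" if "i < k" for i using that permutes_in_image[OF p, of i] by auto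
    have val: "dlam (\<sigma> ! i) (map (\<lambda>i. x i - x b) \<tau> ! p i) = (if \<sigma> ! i = \<tau> ! p i then 1 else 0)"
      if i: "i < k" for i
    proof -
      have "\<sigma> ! i \<in> A - {b}" "\<tau> ! p i \<in> A - {b}"
        using subsetD[OF sets(1) nth_mem, of i] subsetD[OF sets(2) nth_mem, of "p i"] i pk[OF i] len
        by simp_all
      then show ?thesis using pk[OF i] len A b by (auto simp: dlam_edge subset_iff)
    qed
    show ?thesis
    proof (cases "\<forall>i<k. \<sigma> ! i = \<tau> ! p i")
      case True
      have "set \<sigma> \<subseteq> set \<tau>"
      proof
        fix s assume "s \<in> set \<sigma>"
        then obtain i where "i < k" "s = \<sigma> ! i" using len by (auto simp: in_set_conv_nth)
        then show "s \<in> set \<tau>" using True pk len by simp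
      qed
      moreover have "card (set \<sigma>) = k" "card (set \<tau>) = k"
        using sorted len by (auto simp: strict_sorted_iff distinct_card)
      ultimately have "set \<sigma> = set \<tau>" by (simp add: card_subset_eq)
      then have "\<sigma> = \<tau>" using sorted strict_sorted_equal by blast
      moreover have "p = id"
      proof
        fix i
        show "p i = id i"
        proof (cases "i < k")
          case True
          then show ?thesis
            using \<open>\<forall>i<k. \<sigma> ! i = \<tau> ! p i\<close> \<open>\<sigma> = \<tau>\<close> sorted(2) len pk[OF True]
            by (metis id_apply nth_eq_iff_index_eq strict_sorted_iff)
        next
          case False
          then show ?thesis using p by (simp add: permutes_def)
        qed
      qed
      ultimately show ?thesis using val True by simp
    next
      case False
      then obtain i where "i < k" "\<sigma> ! i \<noteq> \<tau> ! p i" by auto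
      then have "(\<Prod>i<k. dlam (\<sigma> ! i) (map (\<lambda>i. x i - x b) \<tau> ! p i)) = 0"
        using val by (intro prod_zero) auto
      then show ?thesis using False by auto
    qed
  qed
  have "set \<sigma> \<subseteq> A" using sets by auto
  from wedge_d_bary[OF A this y arg]
  have "wedge (face A) (map (d_bary x (face A)) \<sigma>) y (map (\<lambda>i. x i - x b) \<tau>)
    = (\<Sum>p | p permutes {..<k}. of_int (sign p) * (if \<sigma> = \<tau> \<and> p = id then 1 else 0))"
    using summand len by simp
  also have "\<dots> = (\<Sum>p | p permutes {..<k}. if p = id then (if \<sigma> = \<tau> then 1 else 0) else 0)"
    by (intro sum.cong) (auto simp: sign_id)
  also have "\<dots> = (if \<sigma> = \<tau> then 1 else 0)"
    by (simp add: finite_permutations permutes_id)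
  finally show ?thesis .
qed

lemma wedge_d_bary_multilinear_alternating:
  assumes "A \<subseteq> N" "\<sigma> \<in> increasing_lists A k" "y \<in> face A"
  shows "multilinear_alternating k (face A) (wedge (face A) (map (d_bary x (face A)) \<sigma>) y)"
proof (rule wedge_multilinear_alternating[OF assms(3)])
  show "length (map (d_bary x (face A)) \<sigma>) = k" using assms by (simp add: increasing_lists_def)
  fix \<theta> u w and c d :: real
  assume "\<theta> \<in> set (map (d_bary x (face A)) \<sigma>)" and uw: "u \<in> tangent (face A)" "w \<in> tangent (face A)"
  then obtain i where i: "i \<in> A" "\<theta> = d_bary x (face A) i" using assms by (auto simp: increasing_lists_def)
  have L: "linear (dlam i)" using i assms linear_dlam by blast
  show "\<theta> y (c *\<^sub>R u + d *\<^sub>R w) = c * \<theta> y u + d * \<theta> y w"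
    unfolding i(2) using assms i uw
    by (simp add: d_bary_face tangent_add tangent_scale linear_add[OF L] linear_scale[OF L])
qed

lemma tangent_face_span:
  assumes A: "A \<subseteq> N" and b: "b \<in> A"
  shows "tangent (face A) \<subseteq> span ((\<lambda>i. x i - x b) ` (A - {b}))"
proof -
  have "A \<noteq> {}" using b by blast
  then show ?thesis
    unfolding tangent_face[OF A \<open>A \<noteq> {}\<close>] using vanishing_off_face_in_span[OF A b] by blast
qed

text \<open>By duality the difference of both sides vanishes on increasing lists of edges at
  \<open>x b\<close>, hence on all lists of such edges, hence on the tangent space that they span.
  Omitting \<open>b\<close> is what makes the wedges independent.\<close>

lemma alternating_expansion:
  assumes A: "A \<subseteq> N" and b: "b \<in> A" and y: "y \<in> face A"
    and a: "multilinear_alternating k (face A) a" and vs: "vs \<in> form_args k (face A)"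
  shows "a vs = (\<Sum>\<sigma>\<in>increasing_lists (A - {b}) k.
    a (map (\<lambda>i. x i - x b) \<sigma>) * wedge (face A) (map (d_bary x (face A)) \<sigma>) y vs)"
proof -
  let ?e = "\<lambda>i. x i - x b" and ?L = "increasing_lists (A - {b}) k"
  let ?w = "\<lambda>\<sigma>. wedge (face A) (map (d_bary x (face A)) \<sigma>) y"
  let ?s = "\<lambda>vs. \<Sum>\<sigma>\<in>?L. a (map ?e \<sigma>) * ?w \<sigma> vs"
  have e: "?e i \<in> tangent (face A)" if "i \<in> A - {b}" for i
    using that b by (intro edge_in_tangent) simp_all
  have "?L \<subseteq> increasing_lists A k" by (auto simp: increasing_lists_def)
  then have "multilinear_alternating k (face A) ?s"
    using wedge_d_bary_multilinear_alternating[OF A _ y] by (intro multilinear_alternating_sum) blast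
  then have diff: "multilinear_alternating k (face A) (\<lambda>vs. 1 * a vs + (- 1) * ?s vs)"
    by (intro multilinear_alternating_lincomb a)
  have "1 * a vs + (- 1) * ?s vs = 0"
  proof (rule multilinear_eq_0_on_spanning_set[OF diff _ tangent_face_span[OF A b] _ vs])
    show "?e ` (A - {b}) \<subseteq> tangent (face A)" using e by blast
    fix ws assume ws: "length ws = k" "set ws \<subseteq> ?e ` (A - {b})"
    then have "ws \<in> map ?e ` lists (A - {b})"
      unfolding lists_image[symmetric] by (simp add: lists_eq_set)
    then obtain \<tau> where \<tau>: "ws = map ?e \<tau>" "set \<tau> \<subseteq> A - {b}"
      by (auto simp: lists_eq_set)
    show "1 * a ws + (- 1) * ?s ws = 0"
      unfolding \<tau>(1)
    proof (rule alternating_eq_0_if_increasing[OF diff e _ _ \<tau>(2)])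
      fix \<rho> assume \<rho>: "\<rho> \<in> ?L"
      have "?s (map ?e \<rho>) = (\<Sum>\<sigma>\<in>?L. if \<sigma> = \<rho> then a (map ?e \<sigma>) else 0)"
        by (intro sum.cong) (auto simp: wedge_dual_basis[OF A b y _ \<rho>])
      also have "\<dots> = a (map ?e \<rho>)"
        using \<rho> finite_face_indices[OF A] by (simp add: finite_increasing_lists)
      finally show "1 * a (map ?e \<rho>) + (- 1) * ?s (map ?e \<rho>) = 0" by simp
    qed (use ws \<tau> in auto)
  qed
  then show ?thesis by simp
qed

text \<open>Values of \<open>a\<close> at other multi-indices or other arguments are junk that the
  form does not see; uniqueness of coefficients is therefore restricted to
  \<open>multi_indices A r\<close> and \<open>form_args k (face A)\<close>.\<close>

definition bform :: "nat set \<Rightarrow> nat \<Rightarrow> nat \<Rightarrow> ((nat \<Rightarrow> nat) \<Rightarrow> (real ^ 'n) list \<Rightarrow> real) \<Rightarrow> 'n form" where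
  "bform A r k a = (\<lambda>y vs. if y \<in> face A \<and> vs \<in> form_args k (face A)
    then bpoly A r (\<lambda>\<beta>. a \<beta> vs) y else 0)"

lemma bform_in_poly_forms:
  assumes A: "A \<subseteq> N" and a: "\<forall>\<beta>\<in>multi_indices A r. multilinear_alternating k (face A) (a \<beta>)"
  shows "bform A r k a \<in> poly_forms r k (face A)"
proof -
  have "multilinear_alternating k (face A) (bform A r k a y)" if y: "y \<in> face A" for y
  proof (rule multilinear_alternating_cong)
    show "multilinear_alternating k (face A) (\<lambda>vs. \<Sum>\<beta>\<in>multi_indices A r. bmono \<beta> y * a \<beta> vs)"
      by (rule multilinear_alternating_sum) (use a in blast)
    show "(\<Sum>\<beta>\<in>multi_indices A r. bmono \<beta> y * a \<beta> vs) = bform A r k a y vs"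
      if "vs \<in> form_args k (face A)" for vs
      using y that by (simp add: bform_def bpoly_def mult.commute)
  qed
  moreover have "\<exists>p. poly_fun r p \<and> (\<forall>y\<in>face A. bform A r k a y vs = p y)"
    if "vs \<in> form_args k (face A)" for vs
    using that poly_fun_bpoly[OF A] by (auto simp: bform_def)
  ultimately show ?thesis by (auto simp: poly_forms_def is_form_def bform_def)
qed

text \<open>The hypothesis yields an unrelated polynomial for each list of vectors. Uniqueness of
  Bernstein coefficients transfers linearity and alternation from the values of the form to the
  coefficients.\<close>

lemma poly_forms_bformE:
  assumes A: "A \<subseteq> N" "A \<noteq> {}" and \<omega>: "\<omega> \<in> poly_forms r k (face A)"
  obtains a where "\<forall>\<beta>\<in>multi_indices A r. multilinear_alternating k (face A) (a \<beta>)"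
    and "\<omega> = bform A r k a"
proof -
  have form: "is_form k (face A) \<omega>" using \<omega> by (simp add: poly_forms_def)
  have "\<forall>vs\<in>form_args k (face A). \<exists>c. \<forall>y\<in>face A. \<omega> y vs = bpoly A r c y"
  proof
    fix vs assume that: "vs \<in> form_args k (face A)"
    have "\<forall>vs\<in>form_args k (face A). \<exists>p. poly_fun r p \<and> (\<forall>y\<in>face A. \<omega> y vs = p y)"
      using \<omega> by (simp add: poly_forms_def)
    from bspec[OF this that] obtain p where p: "poly_fun r p" "\<forall>y\<in>face A. \<omega> y vs = p y"
      by blast
    then show "\<exists>c. \<forall>y\<in>face A. \<omega> y vs = bpoly A r c y"
      using representable_poly_fun[OF A(1) p(1)] by (auto simp: representable_def)
  qed
  from bchoice[OF this] obtain c
    where c: "\<And>vs y. vs \<in> form_args k (face A) \<Longrightarrow> y \<in> face A \<Longrightarrow> \<omega> y vs = bpoly A r (c vs) y"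
    by blast
  define a where "a = (\<lambda>\<beta> vs. c vs \<beta>)"
  have alt: "multilinear_alternating k (face A) (\<omega> y)" if "y \<in> face A" for y
    using form that by (simp add: is_form_def)
  have "multilinear_alternating k (face A) (a \<beta>)" if \<beta>: "\<beta> \<in> multi_indices A r" for \<beta>
  proof (rule multilinear_alternatingI)
    fix vs i u w and s t :: real
    assume *: "vs \<in> form_args k (face A)" "i < k" "u \<in> tangent (face A)" "w \<in> tangent (face A)"
    have args: "vs[i := s *\<^sub>R u + t *\<^sub>R w] \<in> form_args k (face A)" "vs[i := u] \<in> form_args k (face A)"
      "vs[i := w] \<in> form_args k (face A)"
      using * by (auto intro!: form_args_update tangent_add tangent_scale)
    show "a \<beta> (vs[i := s *\<^sub>R u + t *\<^sub>R w]) = s * a \<beta> (vs[i := u]) + t * a \<beta> (vs[i := w])"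
      unfolding a_def
    proof (rule bpoly_unique[OF A _ \<beta>])
      fix y assume y: "y \<in> face A"
      show "bpoly A r (c (vs[i := s *\<^sub>R u + t *\<^sub>R w])) y
        = bpoly A r (\<lambda>\<beta>. s * c (vs[i := u]) \<beta> + t * c (vs[i := w]) \<beta>) y"
        using multilinear_update[OF alt[OF y] *, of s t]
        by (simp only: bpoly_add bpoly_cmult c[OF args(1) y] c[OF args(2) y] c[OF args(3) y])
    qed
  next
    fix vs i j assume *: "vs \<in> form_args k (face A)" "i < k" "j < k" "i \<noteq> j" "vs ! i = vs ! j"
    show "a \<beta> vs = 0"
      unfolding a_def
    proof (rule bpoly_eq_0_imp[OF A _ \<beta>])
      fix y assume y: "y \<in> face A"
      show "bpoly A r (c vs) y = 0" using alternating_eq_0[OF alt[OF y] *] c[OF *(1) y] by simp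
    qed
  qed
  moreover have "\<omega> = bform A r k a"
    using form c by (auto simp: fun_eq_iff bform_def a_def is_form_def)
  ultimately show thesis using that by blast
qed

lemma bform_unique:
  assumes "A \<subseteq> N" "A \<noteq> {}" "bform A r k a = bform A r k b"
    and "\<beta> \<in> multi_indices A r" "vs \<in> form_args k (face A)"
  shows "a \<beta> vs = b \<beta> vs"
proof (rule bpoly_unique[OF assms(1,2) _ assms(4)])
  fix y assume "y \<in> face A"
  then show "bpoly A r (\<lambda>\<beta>. a \<beta> vs) y = bpoly A r (\<lambda>\<beta>. b \<beta> vs) y"
    using fun_cong[OF fun_cong[OF assms(3), of y], of vs] assms(5) by (simp add: bform_def)
qed

lemma bform_cong:
  assumes "\<And>\<beta> vs. \<beta> \<in> multi_indices A r \<Longrightarrow> vs \<in> form_args k (face A) \<Longrightarrow> a \<beta> vs = b \<beta> vs"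
  shows "bform A r k a = bform A r k b"
  using assms by (auto simp: bform_def fun_eq_iff intro!: bpoly_cong)

lemma bform_lincomb:
  "(\<lambda>y vs. c * bform A r k a y vs + d * bform A r k b y vs)
    = bform A r k (\<lambda>\<beta> vs. c * a \<beta> vs + d * b \<beta> vs)"
  by (simp add: bform_def fun_eq_iff bpoly_add bpoly_cmult)

end


section \<open>The extension operator\<close>

lemma multilinear_alternating_subset:
  assumes "multilinear_alternating k S a" "tangent S' \<subseteq> tangent S"
  shows "multilinear_alternating k S' a"
  using multilinear_alternating_map[OF assms(1) linear_id, of S'] assms(2) by auto

text \<open>Contraction fills the first slot; a swap brings any other slot there at the cost of a
  sign.\<close>

lemma contraction_at_index:
  assumes a: "multilinear_alternating k S a" and t: "t \<in> tangent S"
    and 0: "\<And>vs. vs \<in> form_args (k - 1) S \<Longrightarrow> a (t # vs) = 0"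
    and vs: "vs \<in> form_args k S" and i: "i < k"
  shows "a (vs[i := t]) = 0"
proof -
  have hd: "a ws = 0" if "ws \<in> form_args k S" "ws ! 0 = t" for ws
    using that 0[of "tl ws"] i by (cases ws) (auto simp: form_args_def)
  have len: "length vs = k" using vs by (rule form_args_length)
  have ws: "vs[i := t] \<in> form_args k S" using vs t by (rule form_args_update)
  show ?thesis
  proof (cases "i = 0")
    case True
    then show ?thesis using hd[OF ws] i len by simp
  next
    case False
    let ?ws = "vs[i := t]"
    have "?ws[0 := ?ws ! i, i := ?ws ! 0] \<in> form_args k S"
      using form_args_update[OF form_args_update[OF ws form_args_nth[OF ws]] form_args_nth[OF ws]] i
      by simp
    then have "a (?ws[0 := ?ws ! i, i := ?ws ! 0]) = 0"
      by (rule hd) (use i len False in simp)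
    then show ?thesis using alternating_swap[OF a ws, of 0 i] i False by simp
  qed
qed

section \<open>Iterated derivatives along edges leaving the opposite face\<close>

context nondegenerate_simplex
begin

lemma form_args_N: "vs \<in> form_args k (face N) \<longleftrightarrow> length vs = k"
  unfolding form_args_def tangent_face_N by simp

text \<open>As \<open>l\<close> is outside \<open>I\<close>, the direction \<open>x j - x l\<close>
  acts on polynomials in the \<open>lam i\<close>, \<open>i \<in> I\<close>, like the partial
  derivative with respect to \<open>lam j\<close>; \<open>m\<close> steps collect the factors from
  \<gamma>_j + 1 to \<gamma>_j + m.\<close>

lemma dir_deriv_power_bpoly:
  assumes I: "I \<subseteq> N" and j: "j \<in> I" and l: "l \<in> N - I"
    and u: "\<And>z. z \<in> face N \<Longrightarrow> u z = bpoly I (m + s) c z" and y: "y \<in> face N"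
  shows "(dir_deriv (face N) (x j - x l) ^^ m) u y
    = bpoly I s (\<lambda>\<gamma>. pochhammer (real (\<gamma> j) + 1) m * c (\<gamma>(j := \<gamma> j + m))) y"
  using u y
proof (induction m arbitrary: s y)
  case 0
  then show ?case by simp
next
  case (Suc m)
  let ?c = "\<lambda>\<gamma>. pochhammer (real (\<gamma> j) + 1) m * c (\<gamma>(j := \<gamma> j + m))"
  have IH: "(dir_deriv (face N) (x j - x l) ^^ m) u z = bpoly I (Suc s) ?c z" if "z \<in> face N" for z
    by (rule Suc.IH[OF _ that]) (use Suc.prems(1) in simp)
  have "(dir_deriv (face N) (x j - x l) ^^ Suc m) u y = bpoly I s (dcoef I (x j - x l) ?c) y"
    using dir_deriv_bpoly[OF I Suc.prems(2) _ IH] by (simp add: tangent_face_N)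
  also have "\<dots> = bpoly I s (\<lambda>\<gamma>. pochhammer (real (\<gamma> j) + 1) (Suc m) * c (\<gamma>(j := \<gamma> j + Suc m))) y"
  proof (rule bpoly_cong)
    fix \<gamma>
    have "j \<in> N" "l \<in> N" "l \<notin> I" using I j l by auto
    then have "dcoef I (x j - x l) ?c \<gamma> = real (Suc (\<gamma> j)) * ?c (\<gamma>(j := Suc (\<gamma> j)))"
      using j by (simp add: dcoef_edge[OF I])
    then show "dcoef I (x j - x l) ?c \<gamma>
      = pochhammer (real (\<gamma> j) + 1) (Suc m) * c (\<gamma>(j := \<gamma> j + Suc m))"
      by (simp add: pochhammer_rec algebra_simps)
  qed
  finally show ?case .
qed

lemma dir_deriv_foldr_bpoly:
  assumes I: "I \<subseteq> N" and l: "l \<in> N - I" and js: "distinct js" "set js \<subseteq> I"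
    and u: "\<And>z. z \<in> face N \<Longrightarrow> u z = bpoly I (sum \<alpha> (set js) + s) c z" and y: "y \<in> face N"
  shows "foldr (\<lambda>j. dir_deriv (face N) (x j - x l) ^^ \<alpha> j) js u y
    = bpoly I s (\<lambda>\<gamma>. (\<Prod>j\<in>set js. pochhammer (real (\<gamma> j) + 1) (\<alpha> j))
        * c (\<lambda>i. if i \<in> set js then \<gamma> i + \<alpha> i else \<gamma> i)) y"
  using js u y
proof (induction js arbitrary: s y)
  case Nil
  then show ?case by simp
next
  case (Cons j js)
  let ?c = "\<lambda>\<gamma>. (\<Prod>j\<in>set js. pochhammer (real (\<gamma> j) + 1) (\<alpha> j))
        * c (\<lambda>i. if i \<in> set js then \<gamma> i + \<alpha> i else \<gamma> i)"
  have j: "j \<notin> set js" "j \<in> I" using Cons.prems by auto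
  have IH: "foldr (\<lambda>j. dir_deriv (face N) (x j - x l) ^^ \<alpha> j) js u z = bpoly I (\<alpha> j + s) ?c z"
    if "z \<in> face N" for z
    using Cons.prems j by (intro Cons.IH[OF _ _ _ that]) (auto simp: add_ac)
  have "foldr (\<lambda>j. dir_deriv (face N) (x j - x l) ^^ \<alpha> j) (j # js) u y
    = bpoly I s (\<lambda>\<gamma>. pochhammer (real (\<gamma> j) + 1) (\<alpha> j) * ?c (\<gamma>(j := \<gamma> j + \<alpha> j))) y"
    using dir_deriv_power_bpoly[OF I j(2) l IH Cons.prems(4)] by simp
  also have "\<dots> = bpoly I s (\<lambda>\<gamma>. (\<Prod>j\<in>set (j # js). pochhammer (real (\<gamma> j) + 1) (\<alpha> j))
        * c (\<lambda>i. if i \<in> set (j # js) then \<gamma> i + \<alpha> i else \<gamma> i)) y"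
  proof (rule bpoly_cong)
    fix \<gamma>
    have "(\<Prod>i\<in>set js. pochhammer (real ((\<gamma>(j := \<gamma> j + \<alpha> j)) i) + 1) (\<alpha> i))
      = (\<Prod>i\<in>set js. pochhammer (real (\<gamma> i) + 1) (\<alpha> i))"
      using j(1) by (intro prod.cong) auto
    moreover have "(\<lambda>i. if i \<in> set js then (\<gamma>(j := \<gamma> j + \<alpha> j)) i + \<alpha> i else (\<gamma>(j := \<gamma> j + \<alpha> j)) i)
      = (\<lambda>i. if i \<in> set (j # js) then \<gamma> i + \<alpha> i else \<gamma> i)"
      using j(1) by (auto simp: fun_eq_iff)
    ultimately show "pochhammer (real (\<gamma> j) + 1) (\<alpha> j) * ?c (\<gamma>(j := \<gamma> j + \<alpha> j))
      = (\<Prod>j\<in>set (j # js). pochhammer (real (\<gamma> j) + 1) (\<alpha> j))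
        * c (\<lambda>i. if i \<in> set (j # js) then \<gamma> i + \<alpha> i else \<gamma> i)"
      using j(1) by (simp only: list.set prod.insert finite_set mult.assoc not_False_eq_True)
  qed
  finally show ?case .
qed

text \<open>After \<open>r\<close> derivatives the degree is 0, so only \<gamma> = 0 remains, where
  the rising factorials become factorials.\<close>

lemma multi_deriv_bpoly:
  assumes I: "I \<subseteq> N" and l: "l \<in> N - I" and \<alpha>: "\<alpha> \<in> multi_indices I r"
    and u: "\<And>z. z \<in> face N \<Longrightarrow> u z = bpoly I r c z" and y: "y \<in> face N"
  shows "multi_deriv x (face I) l \<alpha> u y = (\<Prod>j\<in>I. fact (\<alpha> j)) * c \<alpha>"
proof -
  have fin: "finite I" using I by (rule finite_face_indices)
  have "sum \<alpha> I = r" using \<alpha> by (simp add: multi_indices_def)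
  then have "multi_deriv x (face I) l \<alpha> u y = bpoly I 0 (\<lambda>\<gamma>. (\<Prod>j\<in>I. pochhammer (real (\<gamma> j) + 1) (\<alpha> j))
        * c (\<lambda>i. if i \<in> I then \<gamma> i + \<alpha> i else \<gamma> i)) y"
    using dir_deriv_foldr_bpoly[OF I l, of "sorted_list_of_set I" u \<alpha> 0 c y] u y fin
    by (simp add: multi_deriv_def indices_face[OF I] simplex_of_eq)
  moreover have "(\<lambda>i. if i \<in> I then 0 + \<alpha> i else 0) = \<alpha>"
    using \<alpha> by (auto simp: multi_indices_def)
  ultimately show ?thesis by (simp add: bpoly_degree_0[OF I] pochhammer_fact)
qed

end

section \<open>Projections onto the tangent space of the face\<close>

locale simplex_face = nondegenerate_simplex x N for x :: "nat \<Rightarrow> real ^ 'n" and N +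
  fixes I :: "nat set" and r :: nat
  assumes I: "I \<subseteq> N" and I_ne: "I \<noteq> {}" and r: "r \<ge> 1"
begin

abbreviation "\<M> \<equiv> multi_indices I r"

text \<open>
  \<open>proj \<alpha>\<close> is the projection onto the tangent space of the face along the vectors \<open>t\<^bsub>\<alpha>l\<^esub>\<close>, \<open>l \<notin> I\<close>, so
  that \<open>\<psi>\<^sub>i\<^sup>\<alpha> = d\<lambda>\<^sub>i \<circ> proj \<alpha>\<close>.
\<close>

definition proj :: "(nat \<Rightarrow> nat) \<Rightarrow> real ^ 'n \<Rightarrow> real ^ 'n" where
  "proj \<alpha> v = (\<Sum>i\<in>I. (dlam i v - real (\<alpha> i) / real r * (\<Sum>j\<in>I. dlam j v)) *\<^sub>R x i)"

definition tvec :: "(nat \<Rightarrow> nat) \<Rightarrow> nat \<Rightarrow> real ^ 'n" where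
  "tvec \<alpha> l = (1 / real r) *\<^sub>R (\<Sum>m\<in>I. real (\<alpha> m) *\<^sub>R (x m - x l))"

text \<open>The value 0 off \<open>\<M>\<close> encodes vanishing to order \<open>r\<close> on the
  opposite face; on \<open>\<M>\<close> this is the pullback along
  \<open>proj \<beta>\<close>.\<close>

definition ext_coeff :: "((nat \<Rightarrow> nat) \<Rightarrow> (real ^ 'n) list \<Rightarrow> real) \<Rightarrow> (nat \<Rightarrow> nat) \<Rightarrow> (real ^ 'n) list \<Rightarrow> real" where
  "ext_coeff a \<beta> vs = (if \<beta> \<in> \<M> then a \<beta> (map (proj \<beta>) vs) else 0)"

lemma finite_I: "finite I"
  using I by (rule finite_face_indices)

lemma sum_weights: "\<alpha> \<in> \<M> \<Longrightarrow> (\<Sum>i\<in>I. real (\<alpha> i) / real r) = 1"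
proof -
  assume "\<alpha> \<in> \<M>"
  then have "sum \<alpha> I = r" by (simp add: multi_indices_def)
  moreover have "(\<Sum>i\<in>I. real (\<alpha> i) / real r) = real (sum \<alpha> I) / real r"
    by (simp only: of_nat_sum sum_divide_distrib)
  ultimately show ?thesis using r by simp
qed

text \<open>The weights sum to 1, so the coefficients in \<open>proj \<alpha> v\<close> sum to 0 and
  can be read off.\<close>

lemma dlam_proj:
  assumes \<alpha>: "\<alpha> \<in> \<M>" and i: "i \<in> N"
  shows "dlam i (proj \<alpha> v) =
    (if i \<in> I then dlam i v - real (\<alpha> i) / real r * (\<Sum>j\<in>I. dlam j v) else 0)"
  unfolding proj_def
  by (rule dlam_eq_on_sum[OF i I]) (simp only: sum_subtractf sum_weights[OF \<alpha>] mult_1_left diff_self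
        flip: sum_distrib_right)

lemma linear_proj: "linear (proj \<alpha>)"
proof -
  have L: "\<And>i. i \<in> I \<Longrightarrow> linear (dlam i)" using I linear_dlam by blast
  have coeff: "linear (\<lambda>v. dlam i v - real (\<alpha> i) / real r * (\<Sum>j\<in>I. dlam j v))" if "i \<in> I" for i
    unfolding real_scaleR_def[symmetric]
    by (intro linear_compose_sub linear_compose_scale_right linear_compose_sum ballI L that)
  show ?thesis
    unfolding proj_def
  proof (intro linear_compose_sum ballI)
    fix i assume "i \<in> I"
    from coeff[OF this]
    show "linear (\<lambda>v. (dlam i v - real (\<alpha> i) / real r * (\<Sum>j\<in>I. dlam j v)) *\<^sub>R x i)"
      by (rule linear_compose[of _ "\<lambda>c. c *\<^sub>R x i", unfolded o_def])
        (simp add: linear_iff scaleR_add_left)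
  qed
qed

lemma proj_in_tangent: "\<alpha> \<in> \<M> \<Longrightarrow> proj \<alpha> v \<in> tangent (face I)"
  by (simp add: tangent_face[OF I I_ne] dlam_proj)

lemma proj_tangent:
  assumes "v \<in> tangent (face I)"
  shows "proj \<alpha> v = v"
proof -
  have v: "\<forall>i\<in>N - I. dlam i v = 0" using assms by (simp add: tangent_face[OF I I_ne])
  show ?thesis by (simp add: proj_def vanishing_off_face[OF I v])
qed

lemma tvec_eq:
  assumes "\<alpha> \<in> \<M>"
  shows "tvec \<alpha> l = (\<Sum>m\<in>I. (real (\<alpha> m) / real r) *\<^sub>R x m) - x l"
proof -
  have "tvec \<alpha> l = (\<Sum>m\<in>I. (real (\<alpha> m) / real r) *\<^sub>R x m) - (\<Sum>m\<in>I. real (\<alpha> m) / real r) *\<^sub>R x l"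
    by (simp add: tvec_def scaleR_sum_right scaleR_diff_right sum_subtractf scaleR_sum_left)
  then show ?thesis by (simp add: sum_weights[OF assms])
qed

lemma t_vec_eq: "\<alpha> \<in> \<M> \<Longrightarrow> t_vec x (face I) l \<alpha> = tvec \<alpha> l"
  by (simp add: t_vec_def tvec_def indices_face[OF I] multi_indices_def)

text \<open>On \<open>tvec \<alpha> l\<close> the \<open>dlam i\<close> with
  \<open>i \<in> I\<close> take the values \<open>\<alpha> i / r\<close>, whose sum is 1, so the
  correction term in \<open>proj\<close> cancels them.\<close>

lemma proj_tvec:
  assumes \<alpha>: "\<alpha> \<in> \<M>" and l: "l \<in> N - I"
  shows "proj \<alpha> (tvec \<alpha> l) = 0"
proof -
  have "dlam i (tvec \<alpha> l) = real (\<alpha> i) / real r" if i: "i \<in> I" for i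
  proof -
    have iN: "i \<in> N" using I i by blast
    have Ld: "linear (dlam i)" using iN by (rule linear_dlam)
    have "dlam i (tvec \<alpha> l) = 1 / real r * (\<Sum>m\<in>I. real (\<alpha> m) * dlam i (x m - x l))"
      by (simp add: tvec_def linear_scale[OF Ld] linear_sum[OF Ld])
    also have "(\<Sum>m\<in>I. real (\<alpha> m) * dlam i (x m - x l)) = (\<Sum>m\<in>I. if i = m then real (\<alpha> m) else 0)"
      using iN l i I by (intro sum.cong refl) (auto simp: dlam_edge subset_iff)
    finally show ?thesis using i finite_I by simp
  qed
  then show ?thesis by (simp add: proj_def sum_weights[OF \<alpha>])
qed

text \<open>The coefficients are forced: for \<open>l\<close> outside \<open>I\<close>,
  \<open>dlam l\<close> is -1 on \<open>tvec \<alpha> l\<close> and 0 on the other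
  \<open>tvec\<close> and on the tangent space of the face.\<close>

lemma proj_decomposition:
  assumes \<alpha>: "\<alpha> \<in> \<M>"
  shows "v = proj \<alpha> v + (\<Sum>l\<in>N - I. (- dlam l v) *\<^sub>R tvec \<alpha> l)"
proof -
  let ?s = "\<Sum>j\<in>I. dlam j v" and ?p = "\<Sum>m\<in>I. (real (\<alpha> m) / real r) *\<^sub>R x m"
  have s: "(\<Sum>l\<in>N - I. dlam l v) = - ?s"
    using sum.subset_diff[OF I finite_N, of "\<lambda>i. dlam i v"] sum_dlam[of v] by simp
  have "(\<Sum>l\<in>N - I. (- dlam l v) *\<^sub>R tvec \<alpha> l)
    = (\<Sum>l\<in>N - I. dlam l v *\<^sub>R x l) - (\<Sum>l\<in>N - I. dlam l v) *\<^sub>R ?p"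
    by (simp add: tvec_eq[OF \<alpha>] scaleR_diff_right sum_subtractf sum_negf
        flip: scaleR_sum_left)
  also have "\<dots> = (\<Sum>l\<in>N - I. dlam l v *\<^sub>R x l) + ?s *\<^sub>R ?p" by (simp add: s)
  finally have "proj \<alpha> v + (\<Sum>l\<in>N - I. (- dlam l v) *\<^sub>R tvec \<alpha> l)
    = (\<Sum>l\<in>N - I. dlam l v *\<^sub>R x l) + (\<Sum>i\<in>I. dlam i v *\<^sub>R x i)"
    by (simp add: proj_def scaleR_diff_left sum_subtractf scaleR_sum_right mult.commute)
  then show ?thesis
    using sum.subset_diff[OF I finite_N, of "\<lambda>i. dlam i v *\<^sub>R x i"] sum_dlam_x[of v] by simp
qed

lemma ext_alternating:
  assumes "\<forall>\<beta>\<in>\<M>. multilinear_alternating k (face I) (a \<beta>)"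
  shows "multilinear_alternating k (face N) (ext_coeff a \<beta>)"
proof (cases "\<beta> \<in> \<M>")
  case True
  then show ?thesis
    using multilinear_alternating_map[OF bspec[OF assms] linear_proj] proj_in_tangent by (simp add: ext_coeff_def[abs_def])
qed (simp add: ext_coeff_def[abs_def] multilinear_alternating_zero)

text \<open>Each argument is its projection plus a combination of the \<open>tvec\<close>. The
  second part contributes 0 in any slot, so arguments can be projected one after the other.\<close>

lemma eq_proj_if_contractions_vanish:
  assumes \<alpha>: "\<alpha> \<in> \<M>" and a: "multilinear_alternating k (face N) a"
    and 0: "\<And>l vs. l \<in> N - I \<Longrightarrow> length vs = k - 1 \<Longrightarrow> k > 0 \<Longrightarrow> a (tvec \<alpha> l # vs) = 0"
    and vs: "length vs = k"
  shows "a (map (proj \<alpha>) vs) = a vs"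
proof (rule multilinear_map_eq[where S = "face N" and k = k])
  fix ws i assume ws: "ws \<in> form_args k (face N)" and i: "i < k"
  have T: "u \<in> tangent (face N)" for u by (simp add: tangent_face_N)
  let ?u = "\<Sum>l\<in>N - I. (- dlam l (ws ! i)) *\<^sub>R tvec \<alpha> l"
  have "?u \<in> span (tvec \<alpha> ` (N - I))" by (intro span_sum span_scale span_base) auto
  then have "a (ws[i := ?u]) = 0"
  proof (induction rule: span_induct_alt)
    case base
    show ?case by (rule multilinear_0[OF a ws i])
  next
    case (step c t w)
    then obtain l where l: "l \<in> N - I" "t = tvec \<alpha> l" by auto
    have "a (ws[i := t]) = 0"
      unfolding l(2) by (rule contraction_at_index[OF a T _ ws i]) (use 0 l i in \<open>simp add: form_args_N\<close>)
    then show ?case using multilinear_update[OF a ws i T T, of c t 1 w] step by simp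
  qed
  then have "a (ws[i := proj \<alpha> (ws ! i) + ?u]) = a (ws[i := proj \<alpha> (ws ! i)])"
    using multilinear_add[OF a ws i T T, of "proj \<alpha> (ws ! i)" ?u] by simp
  then show "a (ws[i := proj \<alpha> (ws ! i)]) = a ws"
    unfolding proj_decomposition[OF \<alpha>, of "ws ! i", symmetric] by simp
qed (use vs in \<open>simp_all add: form_args_N tangent_face_N\<close>)

section \<open>Vanishing to order r^+ in terms of coefficients\<close>

lemma sum_less_iff: "\<beta> \<in> multi_indices N r \<Longrightarrow> sum \<beta> I < r \<longleftrightarrow> \<beta> \<notin> \<M>"
proof -
  assume \<beta>: "\<beta> \<in> multi_indices N r"
  have "sum \<beta> N = sum \<beta> (N - I) + sum \<beta> I" using sum.subset_diff[OF I finite_N] .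
  then have "r = sum \<beta> (N - I) + sum \<beta> I" using \<beta> by (simp add: multi_indices_def)
  then show ?thesis using multi_indices_subset_iff[OF I \<beta>] by linarith
qed

lemma opp_face_eq: "opp_face x (face I) = face (N - I)"
  by (simp add: opp_face_def opp_indices_def indices_face[OF I]) (simp add: face_def N_eq)

lemma form_vanishes_iff:
  "form_vanishes_to_order x k r (bform N r k b) (opp_face x (face I)) \<longleftrightarrow>
    (\<forall>\<beta>\<in>multi_indices N r - \<M>. \<forall>vs. length vs = k \<longrightarrow> b \<beta> vs = 0)"
proof (cases "I = N")
  \<comment> \<open>\<open>vanishes_iff\<close> requires a nonempty opposite face. For
    \<open>f = T\<close> that face is empty, and so is the set of forbidden multi-indices.\<close>
  case True
  then have "opp_face x (face I) = {}" unfolding opp_face_eq by (simp add: face_def)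
  then show ?thesis using True by (simp add: form_vanishes_to_order_def)
next
  case False
  have "(\<forall>y\<in>face (N - I). vanishes_to_order_at (face N) r (\<lambda>z. bform N r k b z vs) y) \<longleftrightarrow>
    (\<forall>\<beta>\<in>multi_indices N r. sum \<beta> I < r \<longrightarrow> b \<beta> vs = 0)" if "length vs = k" for vs
    using that by (intro vanishes_iff[OF I False order_refl]) (simp add: bform_def form_args_N)
  then show ?thesis
    using sum_less_iff by (auto simp: form_vanishes_to_order_def opp_face_eq simplex_of_eq)
qed

lemma multi_deriv_bform:
  assumes 0: "\<forall>\<beta>\<in>multi_indices N r - \<M>. \<forall>vs. length vs = k \<longrightarrow> b \<beta> vs = 0"
    and l: "l \<in> N - I" and \<alpha>: "\<alpha> \<in> \<M>" and y: "y \<in> face N" and vs: "length vs = k"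
  shows "multi_deriv x (face I) l \<alpha> (\<lambda>z. bform N r k b z vs) y = (\<Prod>j\<in>I. fact (\<alpha> j)) * b \<alpha> vs"
proof (rule multi_deriv_bpoly[OF I l \<alpha> _ y])
  fix z assume "z \<in> face N"
  then have "bform N r k b z vs = bpoly N r (\<lambda>\<beta>. b \<beta> vs) z" using vs by (simp add: bform_def form_args_N)
  also have "\<dots> = bpoly I r (\<lambda>\<beta>. b \<beta> vs) z" using 0 vs by (intro bpoly_restrict_coeffs I) simp
  finally show "bform N r k b z vs = bpoly I r (\<lambda>\<beta>. b \<beta> vs) z" .
qed

text \<open>Once the coefficients off \<open>\<M>\<close> are gone, the derivative of order \<alpha>
  is the constant \<alpha>! b_\<alpha> with \<alpha>! nonzero, so its contraction vanishes exactly
  if that of b_\<alpha> does. The guard \<open>k > 0\<close> mirrors the convention that contracting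
  a 0-form gives 0.\<close>

lemma vanishes_plus_iff:
  "vanishes_to_order_plus x (face I) k r (bform N r k b) \<longleftrightarrow>
    (\<forall>\<beta>\<in>multi_indices N r - \<M>. \<forall>vs. length vs = k \<longrightarrow> b \<beta> vs = 0) \<and>
    (\<forall>l\<in>N - I. \<forall>\<alpha>\<in>\<M>. \<forall>vs. length vs = k - 1 \<longrightarrow> k > 0 \<longrightarrow> b \<alpha> (tvec \<alpha> l # vs) = 0)"
    (is "_ \<longleftrightarrow> ?A \<and> ?B")
proof -
  have opp: "opp_indices x (face I) = N - I"
    by (simp add: opp_indices_def indices_face[OF I] N_eq)
  have ne: "x i \<in> face N" if "i \<in> N" for i using that by (rule vertex_in_face)
  have "contract k (\<lambda>ws. multi_deriv x (face I) l \<alpha> (\<lambda>z. bform N r k b z ws) y) (t_vec x (face I) l \<alpha>) vs = 0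
    \<longleftrightarrow> (k > 0 \<longrightarrow> b \<alpha> (tvec \<alpha> l # vs) = 0)"
    if ?A "l \<in> N - I" "\<alpha> \<in> \<M>" "y \<in> face N" "length vs = k - 1" for l \<alpha> y vs
  proof (cases "k = 0")
    case False
    then have "length (tvec \<alpha> l # vs) = k" using that by simp
    moreover have "(\<Prod>j\<in>I. fact (\<alpha> j)) \<noteq> (0 :: real)" using finite_I by simp
    ultimately show ?thesis
      using False multi_deriv_bform[OF that(1-4)] by (simp add: contract_def t_vec_eq[OF that(3)])
  qed (simp add: contract_def)
  \<comment> \<open>A point is needed, as otherwise the condition for all \<open>y\<close> would be
    vacuous and say nothing about the coefficients.\<close>
  moreover have "\<exists>y. y \<in> face N" using ne I I_ne by blast
  ultimately have "?A \<Longrightarrow> (\<forall>l\<in>N - I. \<forall>\<alpha>\<in>\<M>. \<forall>y\<in>face N. \<forall>vs. length vs = k - 1 \<longrightarrow>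
      contract k (\<lambda>ws. multi_deriv x (face I) l \<alpha> (\<lambda>z. bform N r k b z ws) y) (t_vec x (face I) l \<alpha>) vs = 0)
    \<longleftrightarrow> ?B"
    by (smt (verit, ccfv_SIG))
  then show ?thesis
    unfolding vanishes_to_order_plus_def form_vanishes_iff indices_face[OF I] opp simplex_of_eq by blast
qed

lemma bform_ext_vanishing:
  assumes a: "\<forall>\<beta>\<in>\<M>. multilinear_alternating k (face I) (a \<beta>)"
  shows "bform N r k (ext_coeff a) \<in> poly_forms_vanishing x (face I) r k"
proof -
  have "ext_coeff a \<alpha> (tvec \<alpha> l # vs) = 0"
    if l: "l \<in> N - I" and \<alpha>: "\<alpha> \<in> \<M>" and vs: "length vs = k - 1" "k > 0" for l \<alpha> vs
  proof -
    have "(0 # map (proj \<alpha>) vs) \<in> form_args k (face I)"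
      using vs proj_in_tangent[OF \<alpha>] by (auto simp: form_args_def tangent_zero)
    from multilinear_0[OF bspec[OF a \<alpha>] this vs(2)] show ?thesis
      by (simp add: ext_coeff_def \<alpha> proj_tvec[OF \<alpha> l])
  qed
  then have "vanishes_to_order_plus x (face I) k r (bform N r k (ext_coeff a))"
    unfolding vanishes_plus_iff by (simp add: ext_coeff_def)
  moreover have "bform N r k (ext_coeff a) \<in> poly_forms r k (face N)"
    by (intro bform_in_poly_forms order_refl ballI ext_alternating a)
  ultimately show ?thesis by (simp add: poly_forms_vanishing_def simplex_of_eq)
qed

text \<open>The coefficients on the simplex serve as those on the face as well: each equals its own
  pullback along the projection, hence depends only on its values on tangent vectors of the
  face.\<close>

lemma poly_forms_vanishingE:
  assumes "\<omega> \<in> poly_forms_vanishing x (face I) r k"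
  obtains a where "\<forall>\<beta>\<in>\<M>. multilinear_alternating k (face I) (a \<beta>)"
    and "\<omega> = bform N r k (ext_coeff a)"
proof -
  have "N \<noteq> {}" using I I_ne by blast
  then obtain b where b: "\<forall>\<beta>\<in>multi_indices N r. multilinear_alternating k (face N) (b \<beta>)"
    and \<omega>: "\<omega> = bform N r k b"
    using assms poly_forms_bformE[OF order_refl, of \<omega> r k]
    unfolding poly_forms_vanishing_def simplex_of_eq by blast
  have 0: "\<And>\<beta> vs. \<beta> \<in> multi_indices N r - \<M> \<Longrightarrow> length vs = k \<Longrightarrow> b \<beta> vs = 0"
    and contr: "\<And>l \<alpha> vs. l \<in> N - I \<Longrightarrow> \<alpha> \<in> \<M> \<Longrightarrow> length vs = k - 1 \<Longrightarrow> k > 0 \<Longrightarrow> b \<alpha> (tvec \<alpha> l # vs) = 0"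
    using assms unfolding \<omega> poly_forms_vanishing_def mem_Collect_eq vanishes_plus_iff by blast+
  have bI: "multilinear_alternating k (face N) (b \<beta>)" if "\<beta> \<in> \<M>" for \<beta>
    using b that multi_indices_mono[OF I] by blast
  have "\<omega> = bform N r k (ext_coeff b)"
    unfolding \<omega>
  proof (rule bform_cong)
    fix \<beta> vs assume \<beta>: "\<beta> \<in> multi_indices N r" and vs: "vs \<in> form_args k (face N)"
    show "b \<beta> vs = ext_coeff b \<beta> vs"
    proof (cases "\<beta> \<in> \<M>")
      case True
      then show ?thesis
        using eq_proj_if_contractions_vanish[OF True bI[OF True] contr] vs by (simp add: ext_coeff_def form_args_N)
    next
      case False
      then show ?thesis using 0 \<beta> vs by (simp add: ext_coeff_def form_args_N)
    qed
  qed
  moreover have "\<forall>\<beta>\<in>\<M>. multilinear_alternating k (face I) (b \<beta>)"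
    using multilinear_alternating_subset[OF bI] by (simp add: tangent_face_N)
  ultimately show thesis using that by blast
qed

text \<open>On the face the monomials off \<open>\<M>\<close> vanish, and \<open>proj\<close> fixes
  tangent vectors of the face.\<close>

lemma trace_bform_ext: "trace_form (face I) (bform N r k (ext_coeff a)) = bform I r k a"
proof (intro ext)
  fix y vs
  show "trace_form (face I) (bform N r k (ext_coeff a)) y vs = bform I r k a y vs"
  proof (cases "y \<in> face I \<and> vs \<in> form_args k (face I)")
    case True
    then have id: "map (proj \<beta>) vs = vs" for \<beta>
      by (intro map_idI proj_tangent) (auto simp: form_args_def)
    have "trace_form (face I) (bform N r k (ext_coeff a)) y vs = bpoly N r (\<lambda>\<beta>. ext_coeff a \<beta> vs) y"
      using True face_mono[OF I] by (auto simp: trace_form_def bform_def form_args_def tangent_face_N)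
    also have "\<dots> = bpoly I r (\<lambda>\<beta>. ext_coeff a \<beta> vs) y" using True by (intro bpoly_on_face I) simp
    also have "\<dots> = bpoly I r (\<lambda>\<beta>. a \<beta> vs) y" by (intro bpoly_cong) (simp add: ext_coeff_def id)
    finally show ?thesis using True by (simp add: bform_def)
  next
    case False
    then show ?thesis by (auto simp: trace_form_def bform_def form_args_def)
  qed
qed

section \<open>Existence and uniqueness of the extension operator\<close>

definition extend :: "nat \<Rightarrow> 'n form \<Rightarrow> 'n form" where
  "extend k \<mu> = (if \<mu> \<in> poly_forms r k (face I)
    then bform N r k (ext_coeff (SOME a. (\<forall>\<beta>\<in>\<M>. multilinear_alternating k (face I) (a \<beta>)) \<and> \<mu> = bform I r k a))
    else (\<lambda>y vs. 0))"

text \<open>Independence of the choice: \<open>ext_coeff\<close> evaluates coefficients only at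
  indices in \<open>\<M>\<close> and at projected, hence tangent, vectors, where the form determines
  them.\<close>

lemma extend_bform:
  assumes a: "\<forall>\<beta>\<in>\<M>. multilinear_alternating k (face I) (a \<beta>)"
  shows "extend k (bform I r k a) = bform N r k (ext_coeff a)"
proof -
  let ?P = "\<lambda>b. (\<forall>\<beta>\<in>\<M>. multilinear_alternating k (face I) (b \<beta>)) \<and> bform I r k a = bform I r k b"
  have "?P (SOME b. ?P b)" by (rule someI[of ?P a]) (simp add: a)
  then have eq: "bform I r k (SOME b. ?P b) = bform I r k a" by simp
  have "bform N r k (ext_coeff (SOME b. ?P b)) = bform N r k (ext_coeff a)"
  proof (rule bform_cong)
    fix \<beta> vs assume vs: "vs \<in> form_args k (face N)"
    have "map (proj \<beta>) vs \<in> form_args k (face I)" if "\<beta> \<in> \<M>"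
      using form_args_map[OF vs] proj_in_tangent[OF that] .
    then show "ext_coeff (SOME b. ?P b) \<beta> vs = ext_coeff a \<beta> vs"
      using bform_unique[OF I I_ne eq] by (simp add: ext_coeff_def)
  qed
  then show ?thesis using bform_in_poly_forms[OF I a] by (simp add: extend_def)
qed

lemma bary_monomial_face:
  assumes "I \<subseteq> A" "A \<subseteq> N" "\<alpha> \<in> \<M>" "y \<in> face A"
  shows "bary_monomial x (face I) (face A) \<alpha> y = bmono \<alpha> y"
proof -
  have "bary_monomial x (face I) (face A) \<alpha> y = (\<Prod>i\<in>I. lam i y ^ \<alpha> i)"
    unfolding bary_monomial_def indices_face[OF I]
    using assms by (intro prod.cong refl) (auto simp: bary_face)
  also have "\<dots> = bmono \<alpha> y"
    unfolding bmono_def using I assms(3)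
    by (intro prod.mono_neutral_left) (auto simp: multi_indices_def)
  finally show ?thesis .
qed

lemma bpoly_single:
  assumes "A \<subseteq> N" "\<alpha> \<in> multi_indices A r"
  shows "bpoly A r (\<lambda>\<beta>. if \<beta> = \<alpha> then c else 0) y = c * bmono \<alpha> y"
proof -
  have "bpoly A r (\<lambda>\<beta>. if \<beta> = \<alpha> then c else 0) y
    = (\<Sum>\<beta>\<in>multi_indices A r. if \<beta> = \<alpha> then c * bmono \<beta> y else 0)"
    unfolding bpoly_def by (intro sum.cong) auto
  then show ?thesis
    using assms by (simp add: finite_multi_indices finite_face_indices)
qed

definition basis_form :: "(nat \<Rightarrow> nat) \<Rightarrow> nat list \<Rightarrow> 'n form" where
  "basis_form \<alpha> \<sigma> = (\<lambda>y vs. bary_monomial x (face I) (face I) \<alpha> y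
    * wedge (face I) (map (d_bary x (face I)) \<sigma>) y vs)"

text \<open>The wedge of the \<open>d\<lambda>\<^sub>i\<^sup>f\<close> does not depend on the base point; the chosen vertex is arbitrary.\<close>

definition const_wedge :: "(nat \<Rightarrow> nat) \<Rightarrow> nat list \<Rightarrow> (nat \<Rightarrow> nat) \<Rightarrow> (real ^ 'n) list \<Rightarrow> real" where
  "const_wedge \<alpha> \<sigma> \<beta> = (\<lambda>vs. if \<beta> = \<alpha>
    then wedge (face I) (map (d_bary x (face I)) \<sigma>) (x (SOME i. i \<in> I)) vs else 0)"

lemma some_vertex: "x (SOME i. i \<in> I) \<in> face I"
  by (rule vertex_in_face) (simp add: some_in_eq I_ne)

lemma const_wedge_alternating:
  assumes "\<sigma> \<in> increasing_lists I k"
  shows "multilinear_alternating k (face I) (const_wedge \<alpha> \<sigma> \<beta>)"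
  using wedge_d_bary_multilinear_alternating[OF I assms some_vertex]
  by (cases "\<beta> = \<alpha>") (simp_all add: const_wedge_def multilinear_alternating_zero)

lemma basis_form_eq:
  assumes \<alpha>: "\<alpha> \<in> \<M>" and \<sigma>: "\<sigma> \<in> increasing_lists I k"
  shows "basis_form \<alpha> \<sigma> = bform I r k (const_wedge \<alpha> \<sigma>)"
proof (intro ext)
  fix y vs
  have len: "length \<sigma> = k" and set: "set \<sigma> \<subseteq> I" using \<sigma> by (auto simp: increasing_lists_def)
  show "basis_form \<alpha> \<sigma> y vs = bform I r k (const_wedge \<alpha> \<sigma>) y vs"
  proof (cases "y \<in> face I \<and> vs \<in> form_args k (face I)")
    case True
    then have "wedge (face I) (map (d_bary x (face I)) \<sigma>) y vs
      = wedge (face I) (map (d_bary x (face I)) \<sigma>) (x (SOME i. i \<in> I)) vs"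
      using wedge_d_bary[OF I set] some_vertex len by simp
    then show ?thesis
      using True by (simp add: basis_form_def bform_def const_wedge_def bpoly_single[OF I \<alpha>]
          bary_monomial_face[OF order_refl I \<alpha>])
  next
    case False
    then show ?thesis by (auto simp: basis_form_def bform_def wedge_def len)
  qed
qed

lemma psi_eq:
  assumes "\<alpha> \<in> \<M>" "i \<in> I" "y \<in> face N"
  shows "psi x (face I) \<alpha> i y v = dlam i (proj \<alpha> v)"
proof -
  have d: "d_bary x (face N) j y v = dlam j v" if "j \<in> I" for j
    using that I assms(3) by (intro d_bary_face) (auto simp: tangent_face_N)
  have "sum \<alpha> I = r" "i \<in> N" using assms I by (auto simp: multi_indices_def)
  then show ?thesis
    using assms by (simp add: psi_def simplex_of_eq indices_face[OF I] d dlam_proj)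
qed

text \<open>Since \<psi>_i is \<open>dlam i\<close> after \<open>proj \<alpha>\<close>, the
  determinant of the \<psi>_i at \<open>vs\<close> is that of the \<open>dlam i\<close> at the
  projected vectors: the wedge of the \<psi>_i is a pullback.\<close>

lemma extension_formula:
  assumes \<alpha>: "\<alpha> \<in> \<M>" and \<sigma>: "\<sigma> \<in> increasing_lists I k"
  shows "(\<lambda>y vs. bary_monomial x (face I) (simplex_of x) \<alpha> y
      * wedge (simplex_of x) (map (psi x (face I) \<alpha>) \<sigma>) y vs) = bform N r k (ext_coeff (const_wedge \<alpha> \<sigma>))"
proof (intro ext)
  fix y vs
  have len: "length \<sigma> = k" and set: "set \<sigma> \<subseteq> I" using \<sigma> by (auto simp: increasing_lists_def)
  have \<alpha>N: "\<alpha> \<in> multi_indices N r" using \<alpha> multi_indices_mono[OF I] by blast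
  show "bary_monomial x (face I) (simplex_of x) \<alpha> y
      * wedge (simplex_of x) (map (psi x (face I) \<alpha>) \<sigma>) y vs = bform N r k (ext_coeff (const_wedge \<alpha> \<sigma>)) y vs"
  proof (cases "y \<in> face N \<and> length vs = k")
    case True
    then have vs: "vs \<in> form_args k (face N)" by (simp add: form_args_N)
    have pvs: "map (proj \<alpha>) vs \<in> form_args k (face I)"
      using form_args_map[OF vs] proj_in_tangent[OF \<alpha>] .
    let ?W = "wedge (face I) (map (d_bary x (face I)) \<sigma>) (x (SOME i. i \<in> I)) (map (proj \<alpha>) vs)"
    have "wedge (face N) (map (psi x (face I) \<alpha>) \<sigma>) y vs
      = (\<Sum>p | p permutes {..<k}. of_int (sign p) * (\<Prod>i<k. dlam (\<sigma> ! i) (map (proj \<alpha>) vs ! p i)))"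
    proof -
      have "psi x (face I) \<alpha> (\<sigma> ! i) y (vs ! p i) = dlam (\<sigma> ! i) (map (proj \<alpha>) vs ! p i)"
        if "i < k" "p permutes {..<k}" for i p
      proof -
        have "\<sigma> ! i \<in> I" using that(1) len set nth_mem[of i \<sigma>] by blast
        moreover have "p i < length vs" using that permutes_in_image[OF that(2), of i] True by simp
        ultimately show ?thesis using True by (simp add: psi_eq[OF \<alpha>])
      qed
      then show ?thesis
        using True vs len by (auto simp: wedge_def intro!: sum.cong prod.cong)
    qed
    also have "\<dots> = ?W"
      using wedge_d_bary[OF I set some_vertex] pvs len by simp
    finally have wedge: "wedge (face N) (map (psi x (face I) \<alpha>) \<sigma>) y vs = ?W" .
    have "bpoly N r (\<lambda>\<beta>. ext_coeff (const_wedge \<alpha> \<sigma>) \<beta> vs) y = bpoly N r (\<lambda>\<beta>. if \<beta> = \<alpha> then ?W else 0) y"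
      using \<alpha> by (intro bpoly_cong) (auto simp: ext_coeff_def const_wedge_def)
    also have "\<dots> = ?W * bmono \<alpha> y" by (rule bpoly_single[OF order_refl \<alpha>N])
    finally show ?thesis
      using True vs
      by (simp add: bform_def wedge simplex_of_eq bary_monomial_face[OF I order_refl \<alpha>])
  next
    case False
    then show ?thesis
      by (auto simp: bform_def wedge_def len simplex_of_eq form_args_N)
  qed
qed

lemma extend_is_extension_operator: "is_extension_operator x (face I) k r (extend k)"
  unfolding is_extension_operator_def
proof (intro conjI ballI allI)
  fix \<mu> assume "\<mu> \<in> poly_forms r k (face I)"
  then obtain a where a: "\<forall>\<beta>\<in>\<M>. multilinear_alternating k (face I) (a \<beta>)" "\<mu> = bform I r k a"
    using poly_forms_bformE[OF I I_ne] by blast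
  show "extend k \<mu> \<in> poly_forms r k (simplex_of x)"
    unfolding a(2) extend_bform[OF a(1)] simplex_of_eq
    by (intro bform_in_poly_forms order_refl ballI ext_alternating a(1))
next
  fix \<mu> \<nu> and c d :: real
  assume "\<mu> \<in> poly_forms r k (face I)" "\<nu> \<in> poly_forms r k (face I)"
  then obtain a b where a: "\<forall>\<beta>\<in>\<M>. multilinear_alternating k (face I) (a \<beta>)" "\<mu> = bform I r k a"
    and b: "\<forall>\<beta>\<in>\<M>. multilinear_alternating k (face I) (b \<beta>)" "\<nu> = bform I r k b"
    using poly_forms_bformE[OF I I_ne, of _ r k] by (metis (no_types, lifting))
  have "extend k (\<lambda>y vs. c * \<mu> y vs + d * \<nu> y vs)
    = bform N r k (ext_coeff (\<lambda>\<beta> vs. c * a \<beta> vs + d * b \<beta> vs))"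
    unfolding a(2) b(2) bform_lincomb
    using a(1) b(1) by (intro extend_bform ballI multilinear_alternating_lincomb) blast+
  also have "\<dots> = bform N r k (\<lambda>\<beta> vs. c * ext_coeff a \<beta> vs + d * ext_coeff b \<beta> vs)"
    by (intro bform_cong) (simp add: ext_coeff_def)
  also have "\<dots> = (\<lambda>y vs. c * extend k \<mu> y vs + d * extend k \<nu> y vs)"
    unfolding a(2) b(2) extend_bform[OF a(1)] extend_bform[OF b(1)] bform_lincomb ..
  finally show "extend k (\<lambda>y vs. c * \<mu> y vs + d * \<nu> y vs)
    = (\<lambda>y vs. c * extend k \<mu> y vs + d * extend k \<nu> y vs)" .
next
  fix \<alpha> \<sigma>
  assume "\<alpha> \<in> multi_indices (indices x (face I)) r" "\<sigma> \<in> increasing_lists (indices x (face I)) k"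
  then have \<alpha>: "\<alpha> \<in> \<M>" and \<sigma>: "\<sigma> \<in> increasing_lists I k" by (simp_all add: indices_face[OF I])
  show "extend k (\<lambda>y vs. bary_monomial x (face I) (face I) \<alpha> y
      * wedge (face I) (map (d_bary x (face I)) \<sigma>) y vs)
    = (\<lambda>y vs. bary_monomial x (face I) (simplex_of x) \<alpha> y
      * wedge (simplex_of x) (map (psi x (face I) \<alpha>) \<sigma>) y vs)"
    unfolding extension_formula[OF \<alpha> \<sigma>] basis_form_def[of \<alpha> \<sigma>, symmetric] basis_form_eq[OF \<alpha> \<sigma>]
    by (intro extend_bform ballI const_wedge_alternating \<sigma>)
qed

text \<open>Shows that the forms on which the operator is prescribed span its domain; those whose
  \<sigma> avoids \<open>b\<close> already suffice.\<close>

lemma bform_expansion: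
  assumes b: "b \<in> I" and a: "\<forall>\<beta>\<in>\<M>. multilinear_alternating k (face I) (a \<beta>)"
  shows "bform I r k a = (\<lambda>y vs. \<Sum>(\<alpha>, \<sigma>)\<in>\<M> \<times> increasing_lists (I - {b}) k.
    a \<alpha> (map (\<lambda>i. x i - x b) \<sigma>) * basis_form \<alpha> \<sigma> y vs)"
proof (intro ext)
  fix y vs
  let ?L = "increasing_lists (I - {b}) k"
  show "bform I r k a y vs = (\<Sum>(\<alpha>, \<sigma>)\<in>\<M> \<times> ?L.
    a \<alpha> (map (\<lambda>i. x i - x b) \<sigma>) * basis_form \<alpha> \<sigma> y vs)"
  proof (cases "y \<in> face I \<and> vs \<in> form_args k (face I)")
    case True
    then have "bform I r k a y vs = (\<Sum>\<alpha>\<in>\<M>. a \<alpha> vs * bmono \<alpha> y)"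
      by (simp add: bform_def bpoly_def)
    also have "\<dots> = (\<Sum>\<alpha>\<in>\<M>. \<Sum>\<sigma>\<in>?L. a \<alpha> (map (\<lambda>i. x i - x b) \<sigma>) * basis_form \<alpha> \<sigma> y vs)"
    proof (rule sum.cong[OF refl])
      fix \<alpha> assume \<alpha>: "\<alpha> \<in> \<M>"
      have "a \<alpha> vs = (\<Sum>\<sigma>\<in>?L. a \<alpha> (map (\<lambda>i. x i - x b) \<sigma>)
        * wedge (face I) (map (d_bary x (face I)) \<sigma>) y vs)"
        using True by (intro alternating_expansion[OF I b _ bspec[OF a \<alpha>]]) auto
      then show "a \<alpha> vs * bmono \<alpha> y
        = (\<Sum>\<sigma>\<in>?L. a \<alpha> (map (\<lambda>i. x i - x b) \<sigma>) * basis_form \<alpha> \<sigma> y vs)"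
        using True by (simp add: basis_form_def bary_monomial_face[OF order_refl I \<alpha>]
            sum_distrib_right sum_distrib_left mult_ac)
    qed
    finally show ?thesis by (simp add: sum.cartesian_product)
  next
    case False
    have "basis_form \<alpha> \<sigma> y vs = 0" if "\<sigma> \<in> ?L" for \<alpha> \<sigma>
      using False that by (auto simp: basis_form_def wedge_def increasing_lists_def)
    then have "(\<Sum>(\<alpha>, \<sigma>)\<in>\<M> \<times> ?L. a \<alpha> (map (\<lambda>i. x i - x b) \<sigma>) * basis_form \<alpha> \<sigma> y vs) = 0"
      by (intro sum.neutral) auto
    then show ?thesis using False by (auto simp: bform_def)
  qed
qed

lemma poly_forms_lincomb:
  assumes "\<mu> \<in> poly_forms r k (face I)" "\<nu> \<in> poly_forms r k (face I)"
  shows "(\<lambda>y vs. c * \<mu> y vs + d * \<nu> y vs) \<in> poly_forms r k (face I)"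
proof -
  obtain a b where a: "\<forall>\<beta>\<in>\<M>. multilinear_alternating k (face I) (a \<beta>)" "\<mu> = bform I r k a"
    and b: "\<forall>\<beta>\<in>\<M>. multilinear_alternating k (face I) (b \<beta>)" "\<nu> = bform I r k b"
    using assms poly_forms_bformE[OF I I_ne] by metis
  show ?thesis
    unfolding a(2) b(2) bform_lincomb
    using a(1) b(1) by (intro bform_in_poly_forms I ballI multilinear_alternating_lincomb) blast+
qed

lemma extension_operator_unique:
  assumes E: "is_extension_operator x (face I) k r E" and F: "is_extension_operator x (face I) k r F"
    and \<mu>: "\<mu> \<in> poly_forms r k (face I)"
  shows "E \<mu> = F \<mu>"
proof -
  \<comment> \<open>Membership in the domain is part of \<open>G\<close> because the operators are
    assumed linear only there.\<close>
  define G where "G = {\<nu> \<in> poly_forms r k (face I). E \<nu> = F \<nu>}"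
  have lin: "(\<lambda>y vs. c * \<nu> y vs + d * \<nu>' y vs) \<in> G" if "\<nu> \<in> G" "\<nu>' \<in> G" for \<nu> \<nu>' c d
  proof -
    have P: "\<nu> \<in> poly_forms r k (face I)" "\<nu>' \<in> poly_forms r k (face I)" and eq: "E \<nu> = F \<nu>" "E \<nu>' = F \<nu>'"
      using that by (auto simp: G_def)
    have "E (\<lambda>y vs. c * \<nu> y vs + d * \<nu>' y vs) = (\<lambda>y vs. c * E \<nu> y vs + d * E \<nu>' y vs)"
      "F (\<lambda>y vs. c * \<nu> y vs + d * \<nu>' y vs) = (\<lambda>y vs. c * F \<nu> y vs + d * F \<nu>' y vs)"
      using E F P unfolding is_extension_operator_def by blast+
    then show ?thesis using eq poly_forms_lincomb[OF P] by (simp add: G_def)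
  qed
  have zero: "(\<lambda>y vs. 0) \<in> G"
  proof -
    have "E (\<lambda>y vs. 0 * \<mu> y vs + 0 * \<mu> y vs) = (\<lambda>y vs. 0 * E \<mu> y vs + 0 * E \<mu> y vs)"
      "F (\<lambda>y vs. 0 * \<mu> y vs + 0 * \<mu> y vs) = (\<lambda>y vs. 0 * F \<mu> y vs + 0 * F \<mu> y vs)"
      using E F \<mu> unfolding is_extension_operator_def by blast+
    then show ?thesis using poly_forms_lincomb[OF \<mu> \<mu>, of 0 0] by (simp add: G_def)
  qed
  have basis: "basis_form \<alpha> \<sigma> \<in> G" if \<alpha>: "\<alpha> \<in> \<M>" and \<sigma>: "\<sigma> \<in> increasing_lists I k" for \<alpha> \<sigma>
  proof -
    have "E (basis_form \<alpha> \<sigma>) = F (basis_form \<alpha> \<sigma>)"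
      using E F \<alpha> \<sigma> unfolding is_extension_operator_def indices_face[OF I] basis_form_def by simp
    then show ?thesis
      unfolding G_def basis_form_eq[OF \<alpha> \<sigma>]
      using bform_in_poly_forms[OF I ballI[OF const_wedge_alternating[OF \<sigma>]]] by simp
  qed
  have sums: "(\<lambda>y vs. \<Sum>j\<in>B. s j * g j y vs) \<in> G" if "\<And>j. j \<in> B \<Longrightarrow> g j \<in> G"
    for B :: "((nat \<Rightarrow> nat) \<times> nat list) set" and s g
    using that
  proof (induction B rule: infinite_finite_induct)
    case (insert j B)
    then show ?case using lin[of "g j" "\<lambda>y vs. \<Sum>j\<in>B. s j * g j y vs" "s j" 1] by simp
  qed (simp_all add: zero)
  obtain a where a: "\<forall>\<beta>\<in>\<M>. multilinear_alternating k (face I) (a \<beta>)" "\<mu> = bform I r k a"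
    using poly_forms_bformE[OF I I_ne \<mu>] by blast
  obtain b where b: "b \<in> I" using I_ne by blast
  have "(\<lambda>y vs. \<Sum>j\<in>\<M> \<times> increasing_lists (I - {b}) k.
    a (fst j) (map (\<lambda>i. x i - x b) (snd j)) * basis_form (fst j) (snd j) y vs) \<in> G"
    by (rule sums, rule basis) (auto simp: increasing_lists_def)
  then have "\<mu> \<in> G"
    unfolding a(2) bform_expansion[OF b a(1)] by (simp add: case_prod_beta)
  then show ?thesis by (simp add: G_def)
qed

lemma extension_operator_eq: "extension_operator x (face I) k r = extend k"
  unfolding extension_operator_def
proof (rule the_equality)
  show "is_extension_operator x (face I) k r (extend k) \<and>
    (\<forall>\<mu>. \<mu> \<notin> poly_forms r k (face I) \<longrightarrow> extend k \<mu> = (\<lambda>y vs. 0))"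
    using extend_is_extension_operator by (simp add: extend_def)
  fix E
  assume E: "is_extension_operator x (face I) k r E \<and>
    (\<forall>\<mu>. \<mu> \<notin> poly_forms r k (face I) \<longrightarrow> E \<mu> = (\<lambda>y vs. 0))"
  show "E = extend k"
  proof
    fix \<mu>
    show "E \<mu> = extend k \<mu>"
      using E extension_operator_unique[OF _ extend_is_extension_operator]
      by (cases "\<mu> \<in> poly_forms r k (face I)") (auto simp: extend_def)
  qed
qed

text \<open>Together with \<open>trace_extend\<close>, this makes trace and extension mutually
  inverse, which contains both the description of the image and the uniqueness of the
  extension.\<close>

lemma extend_trace:
  assumes "\<omega> \<in> poly_forms_vanishing x (face I) r k"
  shows "trace_form (face I) \<omega> \<in> poly_forms r k (face I)" "extend k (trace_form (face I) \<omega>) = \<omega>"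
proof -
  obtain a where a: "\<forall>\<beta>\<in>\<M>. multilinear_alternating k (face I) (a \<beta>)"
    and \<omega>: "\<omega> = bform N r k (ext_coeff a)"
    using poly_forms_vanishingE[OF assms] by blast
  show "trace_form (face I) \<omega> \<in> poly_forms r k (face I)"
    unfolding \<omega> trace_bform_ext by (intro bform_in_poly_forms I a)
  show "extend k (trace_form (face I) \<omega>) = \<omega>"
    unfolding \<omega> trace_bform_ext by (rule extend_bform[OF a])
qed

lemma trace_extend:
  assumes "\<mu> \<in> poly_forms r k (face I)"
  shows "extend k \<mu> \<in> poly_forms_vanishing x (face I) r k" "trace_form (face I) (extend k \<mu>) = \<mu>"
proof -
  obtain a where a: "\<forall>\<beta>\<in>\<M>. multilinear_alternating k (face I) (a \<beta>)" and \<mu>: "\<mu> = bform I r k a"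
    using poly_forms_bformE[OF I I_ne assms] by blast
  show "extend k \<mu> \<in> poly_forms_vanishing x (face I) r k"
    unfolding \<mu> extend_bform[OF a] by (rule bform_ext_vanishing[OF a])
  show "trace_form (face I) (extend k \<mu>) = \<mu>"
    unfolding \<mu> extend_bform[OF a] by (rule trace_bform_ext)
qed

end

theorem theorem8p4:
  fixes x :: "nat \<Rightarrow> real ^ 'n" and f :: "(real ^ 'n) set" and r k :: nat
  assumes "is_simplex x"
    and "f \<in> faces x"
    and "r \<ge> 1"
    and "k \<le> CARD('n)"
  shows "poly_forms_vanishing x f r k = extension_operator x f k r ` poly_forms r k f \<and>
         (\<forall>\<mu> \<in> poly_forms r k f.
            extension_operator x f k r \<mu> \<in> poly_forms_vanishing x f r k \<and>
            trace_form f (extension_operator x f k r \<mu>) = \<mu> \<and>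
            (\<forall>\<omega> \<in> poly_forms_vanishing x f r k.
               trace_form f \<omega> = \<mu> \<longrightarrow> \<omega> = extension_operator x f k r \<mu>))"
proof -
  obtain I where IN: "I \<subseteq> {..CARD('n)}" "I \<noteq> {}" "f = convex hull (x ` I)"
    using faces_eq[OF assms(1,2)] by blast
  interpret simplex_face x "{..CARD('n)}" I r
    using assms(1,3) IN(1,2) by unfold_locales simp_all
  have f: "f = face I" using IN(3) by (simp only: face_def)
  show ?thesis
    unfolding f extension_operator_eq
  proof (intro conjI ballI impI equalityI subsetI)
    fix \<omega> assume "\<omega> \<in> poly_forms_vanishing x (face I) r k"
    then show "\<omega> \<in> extend k ` poly_forms r k (face I)"
      using imageI[OF extend_trace(1), of \<omega> k "extend k"] by (simp add: extend_trace(2))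
  next
    fix \<omega> assume "\<omega> \<in> extend k ` poly_forms r k (face I)"
    then show "\<omega> \<in> poly_forms_vanishing x (face I) r k" by (auto intro: trace_extend(1))
  next
    fix \<mu> \<omega> assume "\<omega> \<in> poly_forms_vanishing x (face I) r k" "trace_form (face I) \<omega> = \<mu>"
    then show "\<omega> = extend k \<mu>" by (auto simp: extend_trace(2))
  qed (simp_all add: trace_extend)
qed

end
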